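(* The variety of complex $3$-dimensional $(-1,1)$-superalgebras of type $(2,1)$ has dimension $5$ and has exactly $13$ irreducible components, namely $\overline{\mathcal{O}(\mathbf{R}_{k})}$ for $k\in\{01,03,04,05,07,23,25,26,29,31,32,33,36\}$. In particular, exactly $13$ superalgebras are rigid in this variety.
   Context: All algebras are over $\mathbb{C}$. A superalgebra is a $\mathbb{Z}_2$-graded algebra $A=A_0\oplus A_1$ with $A_iA_j\subseteq A_{i+j \bmod 2}$; $|x|\in\{0,1\}$ is the degree of a homogeneous $x$. It has type $(n,m)$ if $\dim A_0=n$, $\dim A_1=m$. The associator is $(x,y,z)=(xy)z-x(yz)$. A superalgebra is right alternative if $(x,y,z)=-(-1)^{|y||z|}(x,z,y)$ for all homogeneous $x,y,z$. A $(-1,1)$-superalgebra is a right alternative superalgebra satisfying $(x,y,z)+(-1)^{|x||y|+|x||z|}(y,z,x)+(-1)^{|z||y|+|x||z|}(z,x,y)=0$ for all homogeneous $x,y,z$. Geometric setting: fix a graded space $V=V_0\oplus V_1$ of type $(n,m)$ with a homogeneous basis. Superalgebra structures on $V$ are even bilinear maps $\mu:V\times V\to V$, identified with their structure constants; those satisfying a given family of graded polynomial identities form a Zariski-closed subset (an affine variety) of this affine space. The group $GL(V_0)\times GL(V_1)$ acts by $(g*\mu)(x,y)=g\mu(g^{-1}x,g^{-1}y)$; its orbits are the isomorphism classes. $\mathcal{O}(A)$ denotes the orbit of (a structure representing) $A$ and $\overline{\mathcal{O}(A)}$ its Zariski closure. A superalgebra is rigid if its orbit is open in the variety. The dimension of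 the variety is the maximal dimension of its irreducible components. Superalgebras of type $(2,1)$, in basis $e_1,e_2$ (even), $f_1$ (odd), listed by nonzero products (unlisted products are zero): $\mathbf{R}_{01}$: $e_1e_1=e_1,\ e_2e_2=e_2$; $\mathbf{R}_{03}$: $e_1e_1=e_1,\ e_2e_2=e_2,\ e_1f_1=f_1,\ f_1e_1=f_1,\ f_1f_1=e_1$; $\mathbf{R}_{04}$: $e_1e_1=e_1,\ e_2e_2=e_2,\ f_1e_1=f_1$; $\mathbf{R}_{05}$: $e_1e_1=e_1,\ e_2e_2=e_2,\ e_1f_1=f_1$; $\mathbf{R}_{07}$: $e_1e_1=e_1,\ e_2e_2=e_2,\ e_2f_1=f_1,\ f_1e_1=f_1$; $\mathbf{R}_{23}$: $e_1e_1=e_1,\ e_1e_2=e_2$; $\mathbf{R}_{25}$: $e_1e_1=e_1,\ e_2e_1=e_2$; $\mathbf{R}_{26}$: $e_1e_1=e_1,\ e_2e_1=e_2,\ e_1f_1=f_1$; $\mathbf{R}_{29}$: $e_1e_1=e_1,\ e_1e_2=e_2,\ f_1e_1=f_1$; $\mathbf{R}_{31}$: $e_1e_1=e_1,\ e_2e_1=e_2,\ f_1e_1=f_1$; $\mathbf{R}_{32}$: $e_1e_1=e_1,\ e_1e_2=e_2,\ e_1f_1=f_1$; $\mathbf{R}_{33}$: $e_1e_1=e_1,\ e_2e_1=e_2,\ e_1f_1=f_1,\ f_1e_1=f_1$; $\mathbf{R}_{36}$: $e_1e_1=e_1,\ e_1e_2=e_2,\ e_1f_1=f_1,\ f_1e_1=f_1$.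 *)

theory Defs
  imports Main "HOL-Library.Extended_Nat"
begin

datatype idx = e1 | e2 | f1

instance idx :: finite
proof
  have "(UNIV :: idx set) = {e1, e2, f1}" by (auto intro: idx.exhaust)
  then show "finite (UNIV :: idx set)" by (metis finite.emptyI finite_insert)
qed

fun deg :: "idx \<Rightarrow> nat" where
  "deg e1 = 0" | "deg e2 = 0" | "deg f1 = 1"

text \<open>Vectors of V, and bilinear products given by structure constants:
  mu(b_i, b_j) = sum_k c i j k b_k.\<close>
type_synonym vec = "idx \<Rightarrow> complex"
type_synonym sc = "idx \<Rightarrow> idx \<Rightarrow> idx \<Rightarrow> complex"

definition mult :: "sc \<Rightarrow> vec \<Rightarrow> vec \<Rightarrow> vec" where
  "mult c x y = (\<lambda>k. \<Sum>i\<in>UNIV. \<Sum>j\<in>UNIV. x i * y j * c i j k)"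

definition assoc :: "sc \<Rightarrow> vec \<Rightarrow> vec \<Rightarrow> vec \<Rightarrow> vec" where
  "assoc c x y z = (\<lambda>k. mult c (mult c x y) z k - mult c x (mult c y z) k)"

definition homog :: "nat \<Rightarrow> vec \<Rightarrow> bool" where
  "homog d x \<longleftrightarrow> (\<forall>i. deg i \<noteq> d \<longrightarrow> x i = 0)"

definition even_sc :: "sc \<Rightarrow> bool" where
  "even_sc c \<longleftrightarrow> (\<forall>i j k. deg k \<noteq> (deg i + deg j) mod 2 \<longrightarrow> c i j k = 0)"

definition right_alternative :: "sc \<Rightarrow> bool" where
  "right_alternative c \<longleftrightarrow>
    (\<forall>dx\<in>{0,1}. \<forall>dy\<in>{0,1}. \<forall>dz\<in>{0,1}. \<forall>x y z.
       homog dx x \<and> homog dy y \<and> homog dz z \<longrightarrow>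
       assoc c x y z = (\<lambda>k. - ((-1) ^ (dy * dz)) * assoc c x z y k))"

definition minus11_identity :: "sc \<Rightarrow> bool" where
  "minus11_identity c \<longleftrightarrow>
    (\<forall>dx\<in>{0,1}. \<forall>dy\<in>{0,1}. \<forall>dz\<in>{0,1}. \<forall>x y z.
       homog dx x \<and> homog dy y \<and> homog dz z \<longrightarrow>
       (\<forall>k. assoc c x y z k + (-1) ^ (dx * dy + dx * dz) * assoc c y z x k
            + (-1) ^ (dz * dy + dx * dz) * assoc c z x y k = 0))"

definition minus11_variety :: "sc set" where
  "minus11_variety = {c. even_sc c \<and> right_alternative c \<and> minus11_identity c}"

inductive_set poly_funs :: "(sc \<Rightarrow> complex) set" where
  pconst: "(\<lambda>_. a) \<in> poly_funs"
| pcoord: "(\<lambda>c. c i j k) \<in> poly_funs"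
| padd: "p \<in> poly_funs \<Longrightarrow> q \<in> poly_funs \<Longrightarrow> (\<lambda>c. p c + q c) \<in> poly_funs"
| pmult: "p \<in> poly_funs \<Longrightarrow> q \<in> poly_funs \<Longrightarrow> (\<lambda>c. p c * q c) \<in> poly_funs"

definition zclosed :: "sc set \<Rightarrow> bool" where
  "zclosed Z \<longleftrightarrow> (\<exists>P \<subseteq> poly_funs. Z = {c. \<forall>p\<in>P. p c = 0})"

definition zclosure :: "sc set \<Rightarrow> sc set" where
  "zclosure A = \<Inter>{Z. zclosed Z \<and> A \<subseteq> Z}"

definition zirreducible :: "sc set \<Rightarrow> bool" where
  "zirreducible C \<longleftrightarrow> zclosed C \<and> C \<noteq> {} \<and>
     (\<forall>A B. zclosed A \<and> zclosed B \<and> C \<subseteq> A \<union> B \<longrightarrow> C \<subseteq> A \<or> C \<subseteq> B)"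

definition irr_components :: "sc set \<Rightarrow> sc set set" where
  "irr_components X = {C. C \<subseteq> X \<and> zirreducible C \<and>
      (\<forall>D. zirreducible D \<and> C \<subseteq> D \<and> D \<subseteq> X \<longrightarrow> D = C)}"

definition zdim :: "sc set \<Rightarrow> enat" where
  "zdim C = Sup {enat n | n. \<exists>Z :: nat \<Rightarrow> sc set.
      (\<forall>i\<le>n. zirreducible (Z i)) \<and> (\<forall>i<n. Z i \<subset> Z (Suc i)) \<and> Z n \<subseteq> C}"

definition var_dim :: "sc set \<Rightarrow> enat" where
  "var_dim X = Sup (zdim ` irr_components X)"

definition gl_even :: "(idx \<Rightarrow> idx \<Rightarrow> complex) \<Rightarrow> (idx \<Rightarrow> idx \<Rightarrow> complex) \<Rightarrow> bool" where
  "gl_even g h \<longleftrightarrow> (\<forall>i j. deg i \<noteq> deg j \<longrightarrow> g i j = 0) \<and>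
     (\<forall>i j. (\<Sum>k\<in>UNIV. g i k * h k j) = (if i = j then 1 else 0)) \<and>
     (\<forall>i j. (\<Sum>k\<in>UNIV. h i k * g k j) = (if i = j then 1 else 0))"

text \<open>g acts by g b_j = sum_i g i j b_i, h is its inverse;
  (g*mu)(x,y) = g mu(g^{-1}x, g^{-1}y).\<close>
definition act :: "(idx \<Rightarrow> idx \<Rightarrow> complex) \<Rightarrow> (idx \<Rightarrow> idx \<Rightarrow> complex) \<Rightarrow> sc \<Rightarrow> sc" where
  "act g h c = (\<lambda>i j l. \<Sum>a\<in>UNIV. \<Sum>b\<in>UNIV. \<Sum>k\<in>UNIV. h a i * h b j * c a b k * g l k)"

definition orbit :: "sc \<Rightarrow> sc set" where
  "orbit c = {act g h c | g h. gl_even g h}"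

definition rigid_in :: "sc set \<Rightarrow> sc \<Rightarrow> bool" where
  "rigid_in X c \<longleftrightarrow> (\<exists>Z. zclosed Z \<and> orbit c = X - Z)"

definition mk :: "(idx \<times> idx \<times> idx) list \<Rightarrow> sc" where
  "mk L = (\<lambda>i j k. if (i, j, k) \<in> set L then 1 else 0)"

definition "R01 = mk [(e1,e1,e1), (e2,e2,e2)]"
definition "R03 = mk [(e1,e1,e1), (e2,e2,e2), (e1,f1,f1), (f1,e1,f1), (f1,f1,e1)]"
definition "R04 = mk [(e1,e1,e1), (e2,e2,e2), (f1,e1,f1)]"
definition "R05 = mk [(e1,e1,e1), (e2,e2,e2), (e1,f1,f1)]"
definition "R07 = mk [(e1,e1,e1), (e2,e2,e2), (e2,f1,f1), (f1,e1,f1)]"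
definition "R23 = mk [(e1,e1,e1), (e1,e2,e2)]"
definition "R25 = mk [(e1,e1,e1), (e2,e1,e2)]"
definition "R26 = mk [(e1,e1,e1), (e2,e1,e2), (e1,f1,f1)]"
definition "R29 = mk [(e1,e1,e1), (e1,e2,e2), (f1,e1,f1)]"
definition "R31 = mk [(e1,e1,e1), (e2,e1,e2), (f1,e1,f1)]"
definition "R32 = mk [(e1,e1,e1), (e1,e2,e2), (e1,f1,f1)]"
definition "R33 = mk [(e1,e1,e1), (e2,e1,e2), (e1,f1,f1), (f1,e1,f1)]"
definition "R36 = mk [(e1,e1,e1), (e1,e2,e2), (e1,f1,f1), (f1,e1,f1)]"

definition R_list :: "sc list" where
  "R_list = [R01, R03, R04, R05, R07, R23, R25, R26, R29, R31, R32, R33, R36]"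

end

theory Submission
  imports Complex_Main "HOL-Computational_Algebra.Polynomial" "HOL-Library.FuncSet"
    "HOL-Library.Function_Algebras" Defs
begin

text \<open>A structure in the variety consists of a right alternative product on the even plane, the
  multiplicative functionals \<open>\<alpha>\<close>, \<open>\<beta>\<close> by which even elements act on \<open>f1\<close> from the left and from
  the right, and the even vector \<open>\<gamma> = f1 f1\<close>. If some even \<open>v\<close> is independent of \<open>v\<^sup>2\<close>, then
  \<open>v\<^sup>2 v = v v\<^sup>2\<close> makes the even part commutative; it is \<open>v \<complex>[v]\<close> modulo \<open>v (v - r) (v - s)\<close>, the
  values \<open>\<alpha> v\<close>, \<open>\<beta> v\<close> lie in \<open>{0, r, s}\<close>, and \<open>\<gamma>\<close> is an eigenvector of \<open>v\<close>. Moving \<open>r\<close> and \<open>s\<close>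
  to distinct nonzero values deforms the algebra to one of \<open>R01\<close>, \<open>R03\<close>, \<open>R04\<close>, \<open>R05\<close>, \<open>R07\<close>.
  Otherwise the even product is \<open>x y = \<phi>(x) y\<close> or \<open>x y = \<phi>(y) x\<close>, and \<open>\<phi> \<noteq> 0\<close> gives the other
  eight orbits, while \<open>\<phi> = 0\<close> is a limit of \<open>R03\<close>. Explicit equations separate the closures.

  Orbits are images of an open subset of \<open>\<complex>\<^sup>5\<close>, hence irreducible. A chain of \<open>n + 1\<close> irreducible
  closed sets yields \<open>n\<close> functions whose monomials are independent on the largest set; pulling the
  monomials back to \<open>\<complex>\<^sup>5\<close> and counting dimensions gives \<open>n \<le> 5\<close>.\<close>

text \<open>Since \<open>zdim\<close> is defined by chains of irreducible closed sets, the bound 5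
  comes from comparing growth rates. Products of powers below \<open>M\<close> of six separating
  functions give \<open>M ^ 6\<close> independent functions on the largest set of a chain. Pulled
  back along the group parametrization and cleared of denominators, they are polynomials in five
  variables of degree at most a constant times \<open>M\<close>, where the constant depends on the
  chain only. These span a space whose dimension grows like \<open>M ^ 5\<close>, so a large
  \<open>M\<close> gives a contradiction. Rigidity asks for more than separation: outside the
  closures of the other twelve orbits there may remain, besides the orbit of \<open>R\<close>,
  boundary points of its closure. An inequation that holds at \<open>R\<close> and excludes them is
  therefore added: a discriminant, with \<open>c f1 f1 e1\<close> for \<open>R03\<close>, in the
  commutative case, and \<open>c e1 e2 e2 \<noteq> c e2 e1 e2\<close> otherwise. It may fail
  elsewhere on the orbit, because the group translates of a neighbourhood of \<open>R\<close> cover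
  the orbit.\<close>

lemma UNIV_idx: "(UNIV :: idx set) = {e1, e2, f1}"
  by (auto intro: idx.exhaust)

lemma sum_idx: "(\<Sum>i\<in>UNIV. f i) = f e1 + f e2 + (f f1 :: 'a :: comm_monoid_add)"
  by (simp add: UNIV_idx add.assoc)

lemma all_idx: "(\<forall>i. P i) \<longleftrightarrow> P e1 \<and> P e2 \<and> P f1"
  by (auto intro: idx.induct)

section \<open>The Zariski topology on structure constants\<close>

lemma poly_funs_cmult: "p \<in> poly_funs \<Longrightarrow> (\<lambda>c. a * p c) \<in> poly_funs"
  by (rule pmult[OF pconst])

lemma poly_funs_diff: "p \<in> poly_funs \<Longrightarrow> q \<in> poly_funs \<Longrightarrow> (\<lambda>c. p c - q c) \<in> poly_funs"
  using padd[OF _ poly_funs_cmult[of q "-1"], of p] by simp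

lemma poly_funs_uminus: "p \<in> poly_funs \<Longrightarrow> (\<lambda>c. - p c) \<in> poly_funs"
  using poly_funs_cmult[of p "-1"] by simp

lemma poly_funs_sum: "(\<And>i. i \<in> I \<Longrightarrow> p i \<in> poly_funs) \<Longrightarrow> (\<lambda>c. \<Sum>i\<in>I. p i c) \<in> poly_funs"
proof (induction I rule: infinite_finite_induct)
  case (insert i I)
  then show ?case by (simp add: padd)
qed (simp_all add: pconst)

lemma poly_funs_power: "p \<in> poly_funs \<Longrightarrow> (\<lambda>c. p c ^ n) \<in> poly_funs"
  by (induction n) (simp_all add: pconst pmult)

lemmas poly_funs_intros = pconst pcoord padd pmult poly_funs_diff poly_funs_uminus poly_funs_sum
  poly_funs_power

text \<open>Pointwise separation avoids carrying sets of equations: unions multiply the separating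
  functions, preimages compose them with the map.\<close>

lemma zclosed_iff_separated:
  "zclosed Z \<longleftrightarrow> (\<forall>c. c \<notin> Z \<longrightarrow> (\<exists>p\<in>poly_funs. (\<forall>z\<in>Z. p z = 0) \<and> p c \<noteq> 0))"
proof
  assume "zclosed Z"
  then show "\<forall>c. c \<notin> Z \<longrightarrow> (\<exists>p\<in>poly_funs. (\<forall>z\<in>Z. p z = 0) \<and> p c \<noteq> 0)"
    unfolding zclosed_def by blast
next
  assume "\<forall>c. c \<notin> Z \<longrightarrow> (\<exists>p\<in>poly_funs. (\<forall>z\<in>Z. p z = 0) \<and> p c \<noteq> 0)"
  then show "zclosed Z"
    unfolding zclosed_def
    by (intro exI[of _ "{p \<in> poly_funs. \<forall>z\<in>Z. p z = 0}"]) blast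
qed

lemma zclosed_Inter: "(\<And>Z. Z \<in> F \<Longrightarrow> zclosed Z) \<Longrightarrow> zclosed (\<Inter>F)"
  unfolding zclosed_iff_separated by (simp, blast)

lemma zclosed_Int: "zclosed A \<Longrightarrow> zclosed B \<Longrightarrow> zclosed (A \<inter> B)"
  using zclosed_Inter[of "{A, B}"] by auto

lemma zclosed_Un:
  assumes "zclosed A" "zclosed B"
  shows "zclosed (A \<union> B)"
  unfolding zclosed_iff_separated
proof (intro allI impI)
  fix c assume "c \<notin> A \<union> B"
  then obtain p q where "p \<in> poly_funs" "\<forall>z\<in>A. p z = 0" "p c \<noteq> 0"
      "q \<in> poly_funs" "\<forall>z\<in>B. q z = 0" "q c \<noteq> 0"
    using assms unfolding zclosed_iff_separated by (metis UnI1 UnI2)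
  then show "\<exists>r\<in>poly_funs. (\<forall>z\<in>A \<union> B. r z = 0) \<and> r c \<noteq> 0"
    by (intro bexI[of _ "\<lambda>c. p c * q c"]) (auto intro: pmult)
qed

lemma zclosed_zeros: "p \<in> poly_funs \<Longrightarrow> zclosed {c. p c = 0}"
  unfolding zclosed_def by (intro exI[of _ "{p}"]) auto

lemma zclosed_empty: "zclosed {}"
  unfolding zclosed_iff_separated using pconst[of 1] by (metis empty_iff zero_neq_one)

lemma zclosed_UN: "finite I \<Longrightarrow> (\<And>i. i \<in> I \<Longrightarrow> zclosed (A i)) \<Longrightarrow> zclosed (\<Union>i\<in>I. A i)"
  by (induction I rule: finite_induct) (auto intro: zclosed_Un zclosed_empty)

lemma zclosed_all: "(\<And>x. zclosed {c. P x c}) \<Longrightarrow> zclosed {c. \<forall>x. P x c}"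
  using zclosed_Inter[of "range (\<lambda>x. {c. P x c})"] by (auto simp: INTER_eq)

text \<open>\<open>P\<close> does not depend on the point, so the set is the one for
  \<open>Q\<close> or the whole space. With the neighbouring rules this reduces closedness of a set
  given by a formula to polynomiality of both sides of each equation.\<close>

lemma zclosed_imp: "(P \<Longrightarrow> zclosed {c. Q c}) \<Longrightarrow> zclosed {c. P \<longrightarrow> Q c}"
  using zclosed_zeros[OF pconst[of 0]] by (cases P) auto

lemma zclosed_conj: "zclosed {c. P c} \<Longrightarrow> zclosed {c. Q c} \<Longrightarrow> zclosed {c. P c \<and> Q c}"
  using zclosed_Int by (auto simp: Collect_conj_eq)

lemma zclosed_eq: "p \<in> poly_funs \<Longrightarrow> q \<in> poly_funs \<Longrightarrow> zclosed {c. p c = q c}"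
  using zclosed_zeros[OF poly_funs_diff, of p q] by simp

lemma zclosed_zclosure: "zclosed (zclosure A)"
  unfolding zclosure_def by (rule zclosed_Inter) auto

lemma zclosure_subset: "A \<subseteq> zclosure A"
  unfolding zclosure_def by auto

lemma zclosure_minimal: "A \<subseteq> Z \<Longrightarrow> zclosed Z \<Longrightarrow> zclosure A \<subseteq> Z"
  unfolding zclosure_def by auto

lemma in_zclosure_iff:
  "c \<in> zclosure S \<longleftrightarrow> (\<forall>p\<in>poly_funs. (\<forall>s\<in>S. p s = 0) \<longrightarrow> p c = 0)"
proof
  assume c: "c \<in> zclosure S"
  show "\<forall>p\<in>poly_funs. (\<forall>s\<in>S. p s = 0) \<longrightarrow> p c = 0"
  proof (intro ballI impI)
    fix p assume "p \<in> poly_funs" "\<forall>s\<in>S. p s = 0"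
    then have "zclosure S \<subseteq> {c. p c = 0}" by (intro zclosure_minimal zclosed_zeros) auto
    with c show "p c = 0" by auto
  qed
next
  assume "\<forall>p\<in>poly_funs. (\<forall>s\<in>S. p s = 0) \<longrightarrow> p c = 0"
  then show "c \<in> zclosure S"
    using zclosed_zclosure[of S] zclosure_subset[of S] unfolding zclosed_iff_separated by blast
qed

text \<open>Primality of the vanishing ideal is tested on the dense subset \<open>S\<close> only: if
  the closure split properly, two polynomials, each vanishing on one piece and nonzero at a point of
  \<open>S\<close>, would have product zero on \<open>S\<close>.\<close>

lemma zirreducible_zclosure:
  assumes "S \<noteq> {}"
    and prime: "\<And>p q. p \<in> poly_funs \<Longrightarrow> q \<in> poly_funs \<Longrightarrow> \<forall>s\<in>S. p s * q s = 0 \<Longrightarrow>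
      (\<forall>s\<in>S. p s = 0) \<or> (\<forall>s\<in>S. q s = 0)"
  shows "zirreducible (zclosure S)"
  unfolding zirreducible_def
proof (intro conjI allI impI zclosed_zclosure)
  show "zclosure S \<noteq> {}" using assms(1) zclosure_subset by blast
next
  fix A B assume AB: "zclosed A \<and> zclosed B \<and> zclosure S \<subseteq> A \<union> B"
  show "zclosure S \<subseteq> A \<or> zclosure S \<subseteq> B"
  proof (rule ccontr)
    assume "\<not> (zclosure S \<subseteq> A \<or> zclosure S \<subseteq> B)"
    then have "\<not> S \<subseteq> A" "\<not> S \<subseteq> B" using AB zclosure_minimal by blast+
    then obtain s t where st: "s \<in> S" "s \<notin> A" "t \<in> S" "t \<notin> B" by blast
    obtain p where p: "p \<in> poly_funs" "\<forall>z\<in>A. p z = 0" "p s \<noteq> 0"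
      using AB st unfolding zclosed_iff_separated by blast
    obtain q where q: "q \<in> poly_funs" "\<forall>z\<in>B. q z = 0" "q t \<noteq> 0"
      using AB st unfolding zclosed_iff_separated by blast
    have "\<forall>s\<in>S. p s * q s = 0" using p q AB zclosure_subset by fastforce
    with prime p q st show False by blast
  qed
qed

lemma zirreducible_prime:
  assumes "zirreducible Z" "p \<in> poly_funs" "q \<in> poly_funs" "\<forall>z\<in>Z. p z * q z = 0"
  shows "(\<forall>z\<in>Z. p z = 0) \<or> (\<forall>z\<in>Z. q z = 0)"
proof -
  have "Z \<subseteq> {c. p c = 0} \<union> {c. q c = 0}" using assms by auto
  then have "Z \<subseteq> {c. p c = 0} \<or> Z \<subseteq> {c. q c = 0}"
    using assms zclosed_zeros unfolding zirreducible_def by blast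
  then show ?thesis by blast
qed

lemma zirreducible_subset_UN:
  assumes "zirreducible D" "finite I" "\<And>i. i \<in> I \<Longrightarrow> zclosed (A i)" "D \<subseteq> (\<Union>i\<in>I. A i)"
  shows "\<exists>i\<in>I. D \<subseteq> A i"
  using assms(2-4)
proof (induction I rule: finite_induct)
  case empty
  then show ?case using assms(1) by (auto simp: zirreducible_def)
next
  case (insert i I)
  have "zclosed (A i)" "zclosed (\<Union>i\<in>I. A i)" using insert by (auto intro!: zclosed_UN)
  moreover have "D \<subseteq> A i \<union> (\<Union>i\<in>I. A i)" using insert by auto
  ultimately have "D \<subseteq> A i \<or> D \<subseteq> (\<Union>i\<in>I. A i)" using assms(1) unfolding zirreducible_def by blast
  then show ?case using insert by auto
qed

lemma irr_components_UN:
  assumes fin: "finite I" and irr: "\<And>i. i \<in> I \<Longrightarrow> zirreducible (A i)"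
    and anti: "\<And>i j. i \<in> I \<Longrightarrow> j \<in> I \<Longrightarrow> A i \<subseteq> A j \<Longrightarrow> i = j"
  shows "irr_components (\<Union>i\<in>I. A i) = A ` I"
proof -
  have in_one: "\<exists>i\<in>I. D \<subseteq> A i" if "zirreducible D" "D \<subseteq> (\<Union>i\<in>I. A i)" for D
    using zirreducible_subset_UN[OF that(1) fin _ that(2)] irr by (auto simp: zirreducible_def)
  show ?thesis
  proof (intro equalityI subsetI)
    fix C assume C: "C \<in> irr_components (\<Union>i\<in>I. A i)"
    then obtain i where i: "i \<in> I" "C \<subseteq> A i" using in_one[of C] by (auto simp: irr_components_def)
    moreover have "A i \<subseteq> (\<Union>i\<in>I. A i)" using i(1) by (rule UN_upper)
    ultimately have "A i = C" using C irr[OF i(1)] unfolding irr_components_def by simp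
    with i show "C \<in> A ` I" by blast
  next
    fix C assume "C \<in> A ` I"
    then obtain i where i: "i \<in> I" "C = A i" by blast
    have "D = C" if d: "zirreducible D" "C \<subseteq> D" "D \<subseteq> (\<Union>i\<in>I. A i)" for D
    proof -
      obtain j where j: "j \<in> I" "D \<subseteq> A j" using in_one[OF d(1,3)] by blast
      then have "i = j" using anti[of i j] i d(2) by simp
      then show ?thesis using d(2) i(2) j(2) by simp
    qed
    then show "C \<in> irr_components (\<Union>i\<in>I. A i)"
      using i irr[of i] UN_upper[of i I A] by (simp add: irr_components_def)
  qed
qed

lemma poly_funs_tendsto:
  assumes "p \<in> poly_funs" "\<And>i j k. (\<lambda>n. F n i j k) \<longlonglongrightarrow> c i j k"
  shows "(\<lambda>n. p (F n)) \<longlonglongrightarrow> p c"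
  using assms(1)
proof induction
  case (pconst a)
  show ?case by (rule tendsto_const)
next
  case (pcoord i j k)
  show ?case by (rule assms(2))
next
  case (padd p q)
  then show ?case by (intro tendsto_add)
next
  case (pmult p q)
  then show ?case by (intro tendsto_mult)
qed

text \<open>Polynomials are continuous, so Zariski closed sets are closed under coordinatewise
  limits. All degenerations below rest on such limits.\<close>

lemma zclosure_limit:
  assumes "\<And>n. F n \<in> zclosure S" "\<And>i j k. (\<lambda>n. F n i j k) \<longlonglongrightarrow> c i j k"
  shows "c \<in> zclosure S"
  unfolding in_zclosure_iff
proof (intro ballI impI)
  fix p assume p: "p \<in> poly_funs" "\<forall>s\<in>S. p s = 0"
  have "p (F n) = 0" for n using assms(1)[of n] p unfolding in_zclosure_iff by blast
  then show "p c = 0"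
    using poly_funs_tendsto[OF p(1), of F c, OF assms(2)] by (simp add: LIMSEQ_const_iff)
qed

section \<open>The action of the even general linear group\<close>

definition app :: "(idx \<Rightarrow> idx \<Rightarrow> complex) \<Rightarrow> vec \<Rightarrow> vec" where
  "app g x = (\<lambda>l. \<Sum>k\<in>UNIV. g l k * x k)"

definition basis :: "idx \<Rightarrow> vec" where
  "basis i = (\<lambda>j. if i = j then 1 else 0)"

lemma mult_basis: "mult c (basis i) (basis j) = c i j"
  by (cases i; cases j) (simp_all add: mult_def basis_def sum_idx fun_eq_iff)

lemma sum_swap_scaled:
  "(\<Sum>b\<in>B. y b * (\<Sum>k\<in>K. g k * F b k)) = (\<Sum>k\<in>K. g k * (\<Sum>b\<in>B. y b * (F b k :: 'a :: comm_semiring_0)))"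
proof -
  have "(\<Sum>b\<in>B. y b * (\<Sum>k\<in>K. g k * F b k)) = (\<Sum>b\<in>B. \<Sum>k\<in>K. g k * (y b * F b k))"
    by (simp only: sum_distrib_left mult.left_commute)
  also have "\<dots> = (\<Sum>k\<in>K. \<Sum>b\<in>B. g k * (y b * F b k))" by (rule sum.swap)
  finally show ?thesis by (simp only: sum_distrib_left)
qed

text \<open>By bilinearity \<open>act g h\<close> is transport of the product along linear maps; the
  laws of the action then follow from composing maps instead of from index calculations.\<close>

lemma mult_act: "mult (act g h c) x y = app g (mult c (app h x) (app h y))"
proof
  fix l
  have lin: "(\<Sum>i\<in>UNIV. x i * (\<Sum>a\<in>UNIV. h a i * F a)) = (\<Sum>a\<in>UNIV. app h x a * F a)"
    for x and F :: "idx \<Rightarrow> complex"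
    by (simp add: app_def sum_idx algebra_simps)
  have act: "act g h c i j l = (\<Sum>a\<in>UNIV. h a i * (\<Sum>b\<in>UNIV. h b j * (\<Sum>k\<in>UNIV. g l k * c a b k)))" for i j
    by (simp add: act_def sum_distrib_left mult_ac)
  have "mult (act g h c) x y l =
      (\<Sum>i\<in>UNIV. x i * (\<Sum>j\<in>UNIV. y j * act g h c i j l))"
    by (simp only: mult_def sum_distrib_left mult.assoc)
  also have "\<dots> = (\<Sum>a\<in>UNIV. app h x a * (\<Sum>b\<in>UNIV. app h y b * (\<Sum>k\<in>UNIV. g l k * c a b k)))"
    unfolding act by (subst sum_swap_scaled) (simp only: lin)
  also have "\<dots> = (\<Sum>k\<in>UNIV. g l k * (\<Sum>a\<in>UNIV. app h x a * (\<Sum>b\<in>UNIV. app h y b * c a b k)))"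
    by (simp only: sum_swap_scaled[of "app h y"]) (rule sum_swap_scaled)
  also have "\<dots> = app g (mult c (app h x) (app h y)) l"
    by (simp only: app_def[of g] mult_def sum_distrib_left mult.assoc)
  finally show "mult (act g h c) x y l = app g (mult c (app h x) (app h y)) l" .
qed

lemma sc_eqI: "(\<And>x y. mult c x y = mult d x y) \<Longrightarrow> c = d"
  by (metis mult_basis ext)

definition mcomp :: "(idx \<Rightarrow> idx \<Rightarrow> complex) \<Rightarrow> (idx \<Rightarrow> idx \<Rightarrow> complex) \<Rightarrow> idx \<Rightarrow> idx \<Rightarrow> complex" where
  "mcomp g h = (\<lambda>i j. \<Sum>k\<in>UNIV. g i k * h k j)"

lemma app_mcomp: "app (mcomp g h) x = app g (app h x)"
  by (auto simp: app_def mcomp_def sum_idx algebra_simps fun_eq_iff)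

lemma act_act: "act g h (act g' h' c) = act (mcomp g g') (mcomp h' h) c"
  by (rule sc_eqI) (simp add: mult_act app_mcomp)

lemma app_eqI: "(\<And>x. app g x = app h x) \<Longrightarrow> g = h"
proof (intro ext)
  fix i j assume "\<And>x. app g x = app h x"
  from this[of "basis j"] show "g i j = h i j"
    by (cases j) (auto simp: app_def basis_def sum_idx fun_eq_iff)
qed

definition idm :: "idx \<Rightarrow> idx \<Rightarrow> complex" where
  "idm = (\<lambda>i j. if i = j then 1 else 0)"

lemma app_idm: "app idm x = x"
proof
  show "app idm x i = x i" for i
    by (cases i) (simp_all add: app_def idm_def sum_idx)
qed

lemma gl_even_iff:
  "gl_even g h \<longleftrightarrow> (\<forall>i j. deg i \<noteq> deg j \<longrightarrow> g i j = 0) \<and> mcomp g h = idm \<and> mcomp h g = idm"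
  by (auto simp: gl_even_def mcomp_def idm_def fun_eq_iff)

text \<open>\<open>gl_even\<close> asks for vanishing mixed blocks of \<open>g\<close> only. On the
  odd line \<open>g\<close> is the nonzero scalar \<open>g f1 f1\<close>, and the mixed entries of
  the two inverse equations are this scalar times the mixed entries of \<open>h\<close>.\<close>

lemma gl_even_inverse_even:
  assumes "gl_even g h" "deg i \<noteq> deg j"
  shows "h i j = 0"
proof -
  have z: "g e1 f1 = 0" "g e2 f1 = 0" "g f1 e1 = 0" "g f1 e2 = 0"
    using assms(1) by (auto simp: gl_even_def)
  have gh: "(\<Sum>k\<in>UNIV. g i k * h k j) = (if i = j then 1 else 0)"
    "(\<Sum>k\<in>UNIV. h i k * g k j) = (if i = j then 1 else 0)" for i j
    using assms(1) by (auto simp: gl_even_def)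
  have t: "g f1 f1 * h f1 f1 = 1" using gh(1)[of f1 f1] z by (simp add: sum_idx)
  have "h e1 f1 * g f1 f1 = 0" "h e2 f1 * g f1 f1 = 0" "g f1 f1 * h f1 e1 = 0" "g f1 f1 * h f1 e2 = 0"
    using gh(2)[of e1 f1] gh(2)[of e2 f1] gh(1)[of f1 e1] gh(1)[of f1 e2] z by (auto simp: sum_idx)
  then show ?thesis using t assms(2) by (cases i; cases j) auto
qed

lemma mcomp_assoc: "mcomp (mcomp a b) c = mcomp a (mcomp b c)"
  by (rule app_eqI) (simp add: app_mcomp)

lemma mcomp_idm: "mcomp idm g = g" "mcomp g idm = g"
  by (rule app_eqI, simp add: app_mcomp app_idm)+

lemma gl_even_sym: "gl_even g h \<Longrightarrow> gl_even h g"
  using gl_even_inverse_even by (auto simp: gl_even_iff)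

lemma gl_even_idm: "gl_even idm idm"
  by (simp add: gl_even_iff mcomp_idm) (auto simp: idm_def)

lemma gl_even_mcomp:
  assumes "gl_even g h" "gl_even g' h'"
  shows "gl_even (mcomp g g') (mcomp h' h)"
proof -
  have "mcomp (mcomp g g') (mcomp h' h) = mcomp g (mcomp (mcomp g' h') h)"
    "mcomp (mcomp h' h) (mcomp g g') = mcomp h' (mcomp (mcomp h g) g')"
    by (simp_all add: mcomp_assoc)
  moreover have "mcomp g g' i j = 0" if "deg i \<noteq> deg j" for i j
    using that assms unfolding gl_even_def mcomp_def by (cases i; cases j) (auto simp: sum_idx)
  ultimately show ?thesis using assms by (simp add: gl_even_iff mcomp_idm)
qed

lemma act_idm: "act idm idm c = c"
  by (rule sc_eqI) (simp add: mult_act app_idm)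

lemma act_inverse: "gl_even g h \<Longrightarrow> act h g (act g h c) = c"
  by (simp add: act_act act_idm gl_even_iff)

lemma orbit_self: "c \<in> orbit c"
  unfolding orbit_def using gl_even_idm act_idm by (metis (mono_tags, lifting) mem_Collect_eq)

lemma act_in_orbit: "gl_even g h \<Longrightarrow> d \<in> orbit c \<Longrightarrow> act g h d \<in> orbit c"
  unfolding orbit_def by (force simp: act_act dest: gl_even_mcomp)

lemma orbit_subset: "d \<in> orbit c \<Longrightarrow> orbit d \<subseteq> orbit c"
  using act_in_orbit by (auto simp: orbit_def[of d])

lemma orbit_sym: "d \<in> orbit c \<Longrightarrow> c \<in> orbit d"
  unfolding orbit_def using act_inverse gl_even_sym
  by (smt (verit, ccfv_threshold) mem_Collect_eq)

lemma orbit_eq: "d \<in> orbit c \<Longrightarrow> orbit d = orbit c"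
  by (simp add: orbit_subset orbit_sym subset_antisym)

lemma act_poly: "(\<lambda>c. act g h c i j k) \<in> poly_funs"
  unfolding act_def by (intro poly_funs_intros)

lemma poly_funs_act: "p \<in> poly_funs \<Longrightarrow> (\<lambda>c. p (act g h c)) \<in> poly_funs"
  by (induction rule: poly_funs.induct) (auto intro: poly_funs_intros act_poly)

lemma zclosed_act: "zclosed Z \<Longrightarrow> zclosed {c. act g h c \<in> Z}"
  unfolding zclosed_iff_separated by (metis mem_Collect_eq poly_funs_act)

text \<open>Membership in an orbit closure may thus be checked at one convenient representative of
  the isomorphism class.\<close>

lemma act_in_zclosure_orbit:
  assumes "gl_even g h" "d \<in> zclosure (orbit c)"
  shows "act g h d \<in> zclosure (orbit c)"
proof -
  have "zclosure (orbit c) \<subseteq> {d. act g h d \<in> zclosure (orbit c)}"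
    using act_in_orbit[OF assms(1)] zclosure_subset
    by (intro zclosure_minimal zclosed_act zclosed_zclosure) blast
  with assms(2) show ?thesis by blast
qed

section \<open>Polynomial functions of the group parameters\<close>

text \<open>\<open>Pol d f\<close> bounds the total degree of \<open>f\<close> by \<open>d\<close>.
  Functions that read only the coordinates 0 to 4 stand for polynomials on affine five-space; only
  upper bounds are kept, so cancellation does not matter.\<close>

inductive Pol :: "nat \<Rightarrow> ((nat \<Rightarrow> complex) \<Rightarrow> complex) \<Rightarrow> bool" where
  Pol_const: "Pol 0 (\<lambda>_. a)"
| Pol_var: "i < 5 \<Longrightarrow> Pol 1 (\<lambda>x. x i)"
| Pol_add: "Pol a f \<Longrightarrow> Pol a g \<Longrightarrow> Pol a (\<lambda>x. f x + g x)"
| Pol_mult: "Pol a f \<Longrightarrow> Pol b g \<Longrightarrow> Pol (a + b) (\<lambda>x. f x * g x)"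
| Pol_mono: "Pol a f \<Longrightarrow> a \<le> b \<Longrightarrow> Pol b f"

lemma Pol_sum: "(\<And>i. i \<in> I \<Longrightarrow> Pol a (f i)) \<Longrightarrow> Pol a (\<lambda>x. \<Sum>i\<in>I. f i x)"
proof (induction I rule: infinite_finite_induct)
  case (insert i I)
  then show ?case by (simp add: Pol_add)
qed (simp_all add: Pol_mono[OF Pol_const])

lemma Pol_power: "Pol a f \<Longrightarrow> Pol (a * n) (\<lambda>x. f x ^ n)"
proof (induction n)
  case (Suc n)
  then show ?case using Pol_mult[of a f "a * n" "\<lambda>x. f x ^ n"] by simp
qed (simp add: Pol_const)

lemma Pol_on_line:
  assumes "Pol a f"
  shows "\<exists>P. \<forall>s. f (\<lambda>i. x i + s * (y i - x i)) = poly P s"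
  using assms
proof induction
  case (Pol_const a)
  show ?case by (intro exI[of _ "[:a:]"]) simp
next
  case (Pol_var i)
  show ?case by (intro exI[of _ "[:x i, y i - x i:]"]) simp
next
  case (Pol_add a f g)
  then obtain P Q where "\<forall>s. f (\<lambda>i. x i + s * (y i - x i)) = poly P s"
    "\<forall>s. g (\<lambda>i. x i + s * (y i - x i)) = poly Q s" by blast
  then show ?case by (intro exI[of _ "P + Q"]) simp
next
  case (Pol_mult a f b g)
  then obtain P Q where "\<forall>s. f (\<lambda>i. x i + s * (y i - x i)) = poly P s"
    "\<forall>s. g (\<lambda>i. x i + s * (y i - x i)) = poly Q s" by blast
  then show ?case by (intro exI[of _ "P * Q"]) simp
qed

section \<open>Dimension of spaces of polynomial functions\<close>

interpretation funs: vector_space "\<lambda>(a :: complex) (f :: (nat \<Rightarrow> complex) \<Rightarrow> complex) x. a * f x"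
  by unfold_locales (auto simp: fun_eq_iff algebra_simps)

text \<open>The exponents fill a cube instead of a simplex, which makes the count a plain power
  while the bounds still add under products.\<close>

definition monoms :: "nat \<Rightarrow> ((nat \<Rightarrow> complex) \<Rightarrow> complex) set" where
  "monoms d = (\<lambda>a x. \<Prod>i<5. x i ^ a i) ` ({..<5} \<rightarrow>\<^sub>E {..d})"

lemma finite_monoms: "finite (monoms d)"
  unfolding monoms_def by (intro finite_imageI finite_PiE) auto

lemma card_monoms: "card (monoms d) \<le> (d + 1) ^ 5"
proof -
  have "card (monoms d) \<le> card ({..<5::nat} \<rightarrow>\<^sub>E {..d})"
    unfolding monoms_def by (intro card_image_le finite_PiE) auto
  also have "\<dots> = (d + 1) ^ 5" by (simp add: card_PiE)
  finally show ?thesis .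
qed

lemma monomsI:
  assumes "\<And>i. i < 5 \<Longrightarrow> a i \<le> d"
  shows "(\<lambda>x. \<Prod>i<5. x i ^ a i) \<in> monoms d"
proof -
  have "(\<lambda>x. \<Prod>i<5. x i ^ a i) = (\<lambda>x. \<Prod>i<5. x i ^ restrict a {..<5} i)"
    by (intro ext prod.cong) auto
  moreover have "restrict a {..<5} \<in> {..<5} \<rightarrow>\<^sub>E {..d}" using assms by auto
  ultimately show ?thesis unfolding monoms_def by blast
qed

lemma monoms_mult:
  assumes "f \<in> monoms a" "g \<in> monoms b"
  shows "(\<lambda>x. f x * g x) \<in> monoms (a + b)"
proof -
  obtain r s where r: "r \<in> {..<5} \<rightarrow>\<^sub>E {..a}" "f = (\<lambda>x. \<Prod>i<5. x i ^ r i)"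
    and s: "s \<in> {..<5} \<rightarrow>\<^sub>E {..b}" "g = (\<lambda>x. \<Prod>i<5. x i ^ s i)"
    using assms unfolding monoms_def by blast
  have "(\<lambda>x. f x * g x) = (\<lambda>x. \<Prod>i<5. x i ^ (r i + s i))"
    using r s by (simp add: prod.distrib power_add)
  moreover have "r i + s i \<le> a + b" if "i < 5" for i
    using r s that by (intro add_mono) (auto simp: PiE_def Pi_def)
  ultimately show ?thesis using monomsI[of "\<lambda>i. r i + s i" "a + b"] by simp
qed

lemma span_monoms_mult:
  assumes f: "f \<in> funs.span (monoms a)" and g: "g \<in> funs.span (monoms b)"
  shows "(\<lambda>x. f x * g x) \<in> funs.span (monoms (a + b))"
  using f
proof (induction rule: funs.span_induct_alt)
  case base
  show ?case using funs.span_zero by (simp add: zero_fun_def)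
next
  case (step c m f)
  have "(\<lambda>x. m x * g x) \<in> funs.span (monoms (a + b))"
    using g
  proof (induction rule: funs.span_induct_alt)
    case base
    show ?case using funs.span_zero by (simp add: zero_fun_def)
  next
    case (step c' m' g)
    have "(\<lambda>x. m x * m' x) \<in> funs.span (monoms (a + b))"
      using monoms_mult[OF \<open>m \<in> monoms a\<close> step(1)] by (rule funs.span_base)
    from funs.span_add[OF funs.span_scale[OF this, of c'] step(2)]
    show ?case by (simp add: algebra_simps plus_fun_def)
  qed
  from funs.span_add[OF funs.span_scale[OF this, of c] step(2)]
  show ?case by (simp add: algebra_simps plus_fun_def)
qed

lemma Pol_span: "Pol d f \<Longrightarrow> f \<in> funs.span (monoms d)"
proof (induction rule: Pol.induct)
  case (Pol_const a)
  have "(\<lambda>x. 1) \<in> monoms 0" using monomsI[of "\<lambda>_. 0" 0] by simp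
  from funs.span_scale[OF funs.span_base[OF this], of a] show ?case by simp
next
  case (Pol_var i)
  have "(\<lambda>x. x i) = (\<lambda>x. \<Prod>j<5. x j ^ (if j = i then 1 else 0) :: complex)"
    using Pol_var by (simp add: fun_eq_iff if_distrib[of "power _"] prod.delta cong: if_cong)
  then show ?case using monomsI[of "\<lambda>j. if j = i then 1 else 0" 1] by (simp add: funs.span_base)
next
  case (Pol_add a f g)
  then show ?case using funs.span_add[of f "monoms a" g] by (simp add: plus_fun_def)
next
  case (Pol_mult a f b g)
  then show ?case by (intro span_monoms_mult)
next
  case (Pol_mono a f b)
  have "monoms a \<subseteq> monoms b"
    unfolding monoms_def using \<open>a \<le> b\<close> by (intro image_mono PiE_mono) auto
  then show ?case using Pol_mono funs.span_mono by blast
qed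

lemma sum_apply: "(\<Sum>i\<in>I. f i) x = (\<Sum>i\<in>I. f i x :: 'b :: comm_monoid_add)"
  by (induction I rule: infinite_finite_induct) simp_all

text \<open>\<open>funs.dependent\<close> speaks of a set of functions, whereas the relation is
  indexed. A repetition in \<open>F\<close> is therefore a case of its own, with the relation
  \<open>F i - F j = 0\<close>.\<close>

lemma Pol_linear_relation:
  assumes "\<And>n. n < N \<Longrightarrow> Pol d (F n)" "(d + 1) ^ 5 < N"
  shows "\<exists>l. (\<exists>n<N. l n \<noteq> 0) \<and> (\<forall>x. (\<Sum>n<N. l n * F n x) = 0)"
proof (cases "inj_on F {..<N}")
  case False
  then obtain i j where ij: "i < N" "j < N" "i \<noteq> j" "F i = F j" unfolding inj_on_def by auto
  define l :: "nat \<Rightarrow> complex" where "l n = (if n = i then 1 else if n = j then -1 else 0)" for n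
  have "(\<Sum>n<N. l n * F n x) = 0" for x
  proof -
    have "(\<Sum>n<N. l n * F n x) = (\<Sum>n\<in>{i, j}. l n * F n x)"
      using ij by (intro sum.mono_neutral_right) (auto simp: l_def)
    then show ?thesis using ij by (simp add: l_def)
  qed
  moreover have "l i \<noteq> 0" by (simp add: l_def)
  ultimately show ?thesis using ij by blast
next
  case True
  have "F ` {..<N} \<subseteq> funs.span (monoms d)" using assms(1) Pol_span by auto
  moreover have "card (monoms d) < card (F ` {..<N})"
    using card_monoms[of d] assms(2) by (simp add: card_image[OF True])
  ultimately have "funs.dependent (F ` {..<N})"
    using funs.independent_span_bound[OF finite_monoms] by (metis not_le)
  then obtain u where u: "\<exists>v\<in>F ` {..<N}. u v \<noteq> 0"
    "(\<Sum>v\<in>F ` {..<N}. (\<lambda>x. u v * v x)) = 0"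
    by (subst (asm) funs.dependent_finite) auto
  have "(\<Sum>n<N. u (F n) * F n x) = 0" for x
  proof -
    have "(\<Sum>n<N. u (F n) * F n x) = (\<Sum>v\<in>F ` {..<N}. u v * v x)"
      by (simp add: sum.reindex[OF True])
    also have "\<dots> = (\<Sum>v\<in>F ` {..<N}. (\<lambda>x. u v * v x)) x"
      by (rule sum_apply[symmetric])
    finally show ?thesis using u(2) by simp
  qed
  with u(1) show ?thesis by (intro exI[of _ "\<lambda>n. u (F n)"]) auto
qed

section \<open>Orbits as images of an open subset of affine five-space\<close>

text \<open>The arguments are listed by columns: \<open>e1\<close> goes to
  \<open>a e1 + b e2\<close>, \<open>e2\<close> to \<open>c e1 + d e2\<close>, and \<open>f1\<close>
  to \<open>t f1\<close>.\<close>

definition gmat :: "complex \<Rightarrow> complex \<Rightarrow> complex \<Rightarrow> complex \<Rightarrow> complex \<Rightarrow> idx \<Rightarrow> idx \<Rightarrow> complex" where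
  "gmat a b c d t = (\<lambda>i j. case i of
      e1 \<Rightarrow> (case j of e1 \<Rightarrow> a | e2 \<Rightarrow> c | f1 \<Rightarrow> 0)
    | e2 \<Rightarrow> (case j of e1 \<Rightarrow> b | e2 \<Rightarrow> d | f1 \<Rightarrow> 0)
    | f1 \<Rightarrow> (case j of e1 \<Rightarrow> 0 | e2 \<Rightarrow> 0 | f1 \<Rightarrow> t))"

definition gmat_inv :: "complex \<Rightarrow> complex \<Rightarrow> complex \<Rightarrow> complex \<Rightarrow> complex \<Rightarrow> idx \<Rightarrow> idx \<Rightarrow> complex" where
  "gmat_inv a b c d t = gmat (d / (a*d - b*c)) (- b / (a*d - b*c)) (- c / (a*d - b*c)) (a / (a*d - b*c)) (1 / t)"

lemma gl_even_gmat:
  assumes "a*d - b*c \<noteq> 0" "t \<noteq> 0"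
  shows "gl_even (gmat a b c d t) (gmat_inv a b c d t)"
proof -
  have "d * a / (a*d - b*c) - b * c / (a*d - b*c) = 1"
    using assms by (simp add: diff_divide_distrib[symmetric] mult.commute)
  moreover have "\<forall>i j. deg i \<noteq> deg j \<longrightarrow> gmat a b c d t i j = 0"
    by (simp add: all_idx gmat_def)
  ultimately show ?thesis
    using assms unfolding gl_even_def
    by (simp add: all_idx sum_idx gmat_def gmat_inv_def algebra_simps)
qed

lemma gl_even_cases:
  assumes "gl_even g h"
  obtains a b c d t where "a*d - b*c \<noteq> 0" "t \<noteq> 0" "g = gmat a b c d t" "h = gmat_inv a b c d t"
proof -
  define a b c d t where "a = g e1 e1" and "b = g e2 e1" and "c = g e1 e2" and "d = g e2 e2" and "t = g f1 f1"
  have g: "g = gmat a b c d t"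
    using assms by (auto simp: gl_even_def gmat_def a_def b_def c_def d_def t_def fun_eq_iff split: idx.split)
  have e: "g e1 f1 = 0" "g e2 f1 = 0" "g f1 e1 = 0" "g f1 e2 = 0"
    using assms by (auto simp: gl_even_def)
  have gh: "(\<Sum>k\<in>UNIV. g i k * h k j) = (if i = j then 1 else 0)" for i j
    using assms by (auto simp: gl_even_def)
  have eqs: "a * h e1 e1 + c * h e2 e1 = 1" "a * h e1 e2 + c * h e2 e2 = 0"
    "b * h e1 e1 + d * h e2 e1 = 0" "b * h e1 e2 + d * h e2 e2 = 1" "t * h f1 f1 = 1"
    using gh[of e1 e1] gh[of e1 e2] gh[of e2 e1] gh[of e2 e2] gh[of f1 f1] e
    by (simp_all add: sum_idx a_def b_def c_def d_def t_def)
  \<comment> \<open>Multiplicativity of the determinant for the even blocks.\<close>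
  have "(a*d - b*c) * (h e1 e1 * h e2 e2 - h e1 e2 * h e2 e1) = 1"
    using eqs(1-4) by algebra
  then have D: "a*d - b*c \<noteq> 0" by auto
  have t: "t \<noteq> 0" using eqs(5) by auto
  have "mcomp h g = idm" "mcomp (gmat a b c d t) (gmat_inv a b c d t) = idm"
    using assms gl_even_gmat[OF D t] by (simp_all add: gl_even_iff)
  then have "h = gmat_inv a b c d t" unfolding g by (metis mcomp_assoc mcomp_idm)
  with that D t g show ?thesis by blast
qed

abbreviation (input) pmat :: "(nat \<Rightarrow> complex) \<Rightarrow> idx \<Rightarrow> idx \<Rightarrow> complex" where
  "pmat x \<equiv> gmat (x 0) (x 1) (x 2) (x 3) (x 4)"

definition pdet :: "(nat \<Rightarrow> complex) \<Rightarrow> complex" where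
  "pdet x = (x 0 * x 3 - x 1 * x 2) * x 4"

definition pact :: "sc \<Rightarrow> (nat \<Rightarrow> complex) \<Rightarrow> sc" where
  "pact c x = act (gmat (x 0) (x 1) (x 2) (x 3) (x 4)) (gmat_inv (x 0) (x 1) (x 2) (x 3) (x 4)) c"

lemma orbit_pact: "orbit c = pact c ` {x. pdet x \<noteq> 0}"
proof (intro equalityI subsetI)
  fix d assume "d \<in> orbit c"
  then obtain g h where gh: "gl_even g h" "d = act g h c" unfolding orbit_def by blast
  from gh(1) obtain r s u v t where "r*v - s*u \<noteq> 0" "t \<noteq> 0" "g = gmat r s u v t" "h = gmat_inv r s u v t"
    by (rule gl_even_cases)
  then have "d = pact c (nth [r, s, u, v, t])" "pdet (nth [r, s, u, v, t]) \<noteq> 0"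
    using gh(2) by (simp_all add: pact_def pdet_def)
  then show "d \<in> pact c ` {x. pdet x \<noteq> 0}" by blast
next
  fix d assume "d \<in> pact c ` {x. pdet x \<noteq> 0}"
  then obtain x where "pdet x \<noteq> 0" "d = pact c x" by blast
  then show "d \<in> orbit c"
    unfolding orbit_def pact_def pdet_def using gl_even_gmat[of "x 0" "x 3" "x 1" "x 2" "x 4"] by auto
qed

lemma Pol_uminus: "Pol a f \<Longrightarrow> Pol a (\<lambda>x. - f x)"
  using Pol_mult[OF Pol_const[of "-1"], of a f] by simp

lemma Pol_zero: "Pol a (\<lambda>_. 0)"
  by (rule Pol_mono[OF Pol_const]) simp

lemma Pol_pdet: "Pol 3 pdet"
proof -
  have "Pol (1 + 1) (\<lambda>x. x 0 * x 3)" "Pol (1 + 1) (\<lambda>x. - (x 1 * x 2))"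
    by (intro Pol_uminus Pol_mult Pol_var; simp)+
  from Pol_mult[OF Pol_add[OF this] Pol_var[of 4]] show ?thesis
    unfolding pdet_def[abs_def] by (simp add: numeral_3_eq_3)
qed

lemma Pol_pmat: "Pol 1 (\<lambda>x. pmat x i j)"
  by (cases i; cases j) (simp_all add: gmat_def Pol_zero Pol_var[simplified])

text \<open>Cramer's rule: multiplication by \<open>pdet\<close> turns the inverse into the
  adjugate, whose entries are quadratic.\<close>

lemma Pol_gmat_inv:
  "\<exists>F. Pol 2 F \<and> (\<forall>x. pdet x \<noteq> 0 \<longrightarrow>
     F x = gmat_inv (x 0) (x 1) (x 2) (x 3) (x 4) i j * pdet x)"
proof -
  have v: "Pol 2 (\<lambda>x. x k * x 4)" "Pol 2 (\<lambda>x. - (x k * x 4))" if "k < 5" for k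
    using Pol_mult[OF Pol_var[OF that] Pol_var[of 4]] by (simp_all add: numeral_2_eq_2 Pol_uminus)
  have "Pol (1 + 1) (\<lambda>x. x 0 * x 3)" "Pol (1 + 1) (\<lambda>x. - (x 1 * x 2))"
    by (intro Pol_uminus Pol_mult Pol_var; simp)+
  from Pol_add[OF this] have d: "Pol 2 (\<lambda>x. x 0 * x 3 - x 1 * x 2)" by (simp add: numeral_2_eq_2)
  define F where
    "F x = gmat (x 3 * x 4) (- (x 1 * x 4)) (- (x 2 * x 4)) (x 0 * x 4) (x 0 * x 3 - x 1 * x 2) i j"
    for x :: "nat \<Rightarrow> complex"
  have "Pol 2 F"
    unfolding F_def[abs_def] using v[of 0] v[of 1] v[of 2] v[of 3] d
    by (cases i; cases j) (simp_all add: gmat_def Pol_zero)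
  moreover have "F x = gmat_inv (x 0) (x 1) (x 2) (x 3) (x 4) i j * pdet x" if "pdet x \<noteq> 0" for x
    using that unfolding F_def pdet_def gmat_inv_def by (cases i; cases j) (simp_all add: gmat_def)
  ultimately show ?thesis by blast
qed

text \<open>A coordinate of \<open>pact c x\<close> contains two entries of the inverse matrix and
  one of the matrix, so \<open>pdet ^ 2\<close> clears its denominators and leaves degree 2 + 2 + 1
  = 5. The rate 6 is the degree of \<open>pdet ^ 2\<close>, which lets \<open>d\<close> be raised by
  multiplying with that factor.\<close>

definition pullback_deg :: "sc \<Rightarrow> nat \<Rightarrow> (sc \<Rightarrow> complex) \<Rightarrow> bool" where
  "pullback_deg c d p \<longleftrightarrow>
    (\<exists>F. Pol (6 * d) F \<and> (\<forall>x. pdet x \<noteq> 0 \<longrightarrow> F x = p (pact c x) * pdet x ^ (2 * d)))"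

lemma pullback_deg_const: "pullback_deg c 0 (\<lambda>_. a)"
  unfolding pullback_deg_def by (auto intro!: exI[of _ "\<lambda>_. a"] Pol_const)

lemma pullback_deg_mult:
  assumes "pullback_deg c a p" "pullback_deg c b q"
  shows "pullback_deg c (a + b) (\<lambda>c. p c * q c)"
proof -
  obtain F G where "Pol (6 * a) F" "\<forall>x. pdet x \<noteq> 0 \<longrightarrow> F x = p (pact c x) * pdet x ^ (2 * a)"
    "Pol (6 * b) G" "\<forall>x. pdet x \<noteq> 0 \<longrightarrow> G x = q (pact c x) * pdet x ^ (2 * b)"
    using assms unfolding pullback_deg_def by blast
  then show ?thesis
    unfolding pullback_deg_def using Pol_mult[of "6 * a" F "6 * b" G]
    by (intro exI[of _ "\<lambda>x. F x * G x"]) (simp add: algebra_simps power_add)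
qed

lemma pullback_deg_mono:
  assumes "pullback_deg c a p" "a \<le> b"
  shows "pullback_deg c b p"
proof -
  have "pullback_deg c (b - a) (\<lambda>_. 1)"
    unfolding pullback_deg_def
    using Pol_power[OF Pol_pdet, of "2 * (b - a)"]
    by (intro exI[of _ "\<lambda>x. pdet x ^ (2 * (b - a))"]) (simp add: algebra_simps)
  from pullback_deg_mult[OF this assms(1)] show ?thesis using assms(2) by simp
qed

lemma pullback_deg_add:
  assumes "pullback_deg c a p" "pullback_deg c b q"
  shows "pullback_deg c (a + b) (\<lambda>c. p c + q c)"
proof -
  have "pullback_deg c (a + b) p" "pullback_deg c (a + b) q"
    using assms pullback_deg_mono by auto
  then obtain F G where
    "Pol (6 * (a + b)) F" "\<forall>x. pdet x \<noteq> 0 \<longrightarrow> F x = p (pact c x) * pdet x ^ (2 * (a + b))"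
    "Pol (6 * (a + b)) G" "\<forall>x. pdet x \<noteq> 0 \<longrightarrow> G x = q (pact c x) * pdet x ^ (2 * (a + b))"
    unfolding pullback_deg_def by blast
  then show ?thesis
    unfolding pullback_deg_def using Pol_add[of "6 * (a + b)" F G]
    by (intro exI[of _ "\<lambda>x. F x + G x"]) (simp add: algebra_simps)
qed

lemma pullback_deg_power: "pullback_deg c a p \<Longrightarrow> pullback_deg c (a * n) (\<lambda>c. p c ^ n)"
proof (induction n)
  case (Suc n)
  then show ?case using pullback_deg_mult[of c a p "a * n" "\<lambda>c. p c ^ n"] by simp
qed (simp add: pullback_deg_const)

lemma pullback_deg_coord: "pullback_deg c 1 (\<lambda>c. c i j l)"
proof -
  obtain H where H: "\<And>i j. Pol 2 (H i j)"
    "\<And>i j x. pdet x \<noteq> 0 \<Longrightarrow> H i j x = gmat_inv (x 0) (x 1) (x 2) (x 3) (x 4) i j * pdet x"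
    using Pol_gmat_inv by metis
  have "Pol 6 (\<lambda>x. \<Sum>a\<in>UNIV. \<Sum>b\<in>UNIV. \<Sum>k\<in>UNIV. H a i x * H b j x * c a b k * pmat x l k)"
    by (intro Pol_sum Pol_mono[OF Pol_mult[OF Pol_mult[OF Pol_mult[OF H(1) H(1)] Pol_const] Pol_pmat]]) simp
  moreover have "(\<Sum>a\<in>UNIV. \<Sum>b\<in>UNIV. \<Sum>k\<in>UNIV. H a i x * H b j x * c a b k * pmat x l k)
      = pact c x i j l * pdet x ^ 2" if "pdet x \<noteq> 0" for x
    unfolding pact_def act_def sum_distrib_right
    by (intro sum.cong refl) (simp add: H(2)[OF that] power2_eq_square)
  ultimately show ?thesis unfolding pullback_deg_def by auto
qed

lemma pullback_deg_exists: "p \<in> poly_funs \<Longrightarrow> \<exists>d. pullback_deg c d p"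
proof (induction rule: poly_funs.induct)
  case (padd p q)
  then show ?case using pullback_deg_add by blast
next
  case (pmult p q)
  then show ?case using pullback_deg_mult by blast
qed (blast intro: pullback_deg_const pullback_deg_coord)+

text \<open>Given two parameters at which two regular functions do not vanish, some point on the line
  through them is a nonzero of both, since polynomials in one variable have finitely many zeros.\<close>

lemma zirreducible_pact_image:
  assumes L: "x0 \<in> L" "pdet x0 \<noteq> 0"
    and line: "\<And>x y s. x \<in> L \<Longrightarrow> y \<in> L \<Longrightarrow> (\<lambda>i. x i + s * (y i - x i)) \<in> L"
  shows "zirreducible (zclosure (pact c ` {x \<in> L. pdet x \<noteq> 0}))"
proof (rule zirreducible_zclosure)
  show "pact c ` {x \<in> L. pdet x \<noteq> 0} \<noteq> {}" using L by blast
next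
  fix p q assume pq: "p \<in> poly_funs" "q \<in> poly_funs"
    and zero: "\<forall>s\<in>pact c ` {x \<in> L. pdet x \<noteq> 0}. p s * q s = 0"
  obtain a F b G where F: "Pol (6 * a) F" "\<And>x. pdet x \<noteq> 0 \<Longrightarrow> F x = p (pact c x) * pdet x ^ (2 * a)"
    and G: "Pol (6 * b) G" "\<And>x. pdet x \<noteq> 0 \<Longrightarrow> G x = q (pact c x) * pdet x ^ (2 * b)"
    using pullback_deg_exists[OF pq(1), of c] pullback_deg_exists[OF pq(2), of c]
    unfolding pullback_deg_def by meson
  show "(\<forall>s\<in>pact c ` {x \<in> L. pdet x \<noteq> 0}. p s = 0) \<or> (\<forall>s\<in>pact c ` {x \<in> L. pdet x \<noteq> 0}. q s = 0)"
  proof (rule ccontr)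
    assume "\<not> ?thesis"
    then obtain x y where x: "x \<in> L" "pdet x \<noteq> 0" "p (pact c x) \<noteq> 0"
      and y: "y \<in> L" "pdet y \<noteq> 0" "q (pact c y) \<noteq> 0" by auto
    let ?z = "\<lambda>s i. x i + s * (y i - x i)"
    obtain P Q D where P: "\<And>s. F (?z s) = poly P s" and Q: "\<And>s. G (?z s) = poly Q s"
      and D: "\<And>s. pdet (?z s) = poly D s"
      using Pol_on_line[OF F(1), of x y] Pol_on_line[OF G(1), of x y] Pol_on_line[OF Pol_pdet, of x y]
      by blast
    have "poly P 0 \<noteq> 0" "poly Q 1 \<noteq> 0" "poly D 0 \<noteq> 0"
      using x y F(2) G(2) by (simp_all add: P[symmetric] Q[symmetric] D[symmetric])
    then have "P * Q * D \<noteq> 0" by auto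
    then have "finite {s. poly (P * Q * D) s = 0}" by (rule poly_roots_finite)
    then obtain s where "poly (P * Q * D) s \<noteq> 0"
      using infinite_UNIV_char_0[where 'a = complex] by (metis (mono_tags, lifting) UNIV_eq_I mem_Collect_eq)
    then have s: "F (?z s) \<noteq> 0" "G (?z s) \<noteq> 0" "pdet (?z s) \<noteq> 0" by (simp_all add: P Q D)
    then have "p (pact c (?z s)) * q (pact c (?z s)) \<noteq> 0" using F(2) G(2) by auto
    moreover have "?z s \<in> L" using line x y by blast
    ultimately show False using zero s(3) by blast
  qed
qed

lemma zirreducible_orbit: "zirreducible (zclosure (orbit c))"
proof -
  have "pdet (\<lambda>i. of_bool (i = 0 \<or> i = 3 \<or> i = 4)) \<noteq> 0" by (simp add: pdet_def)
  from zirreducible_pact_image[OF UNIV_I this] show ?thesis by (simp add: orbit_pact)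
qed

section \<open>Dimension\<close>

definition indep_on :: "sc set \<Rightarrow> nat \<Rightarrow> (nat \<Rightarrow> sc \<Rightarrow> complex) \<Rightarrow> bool" where
  "indep_on Z N Q \<longleftrightarrow> (\<forall>l. (\<forall>z\<in>Z. (\<Sum>n<N. l n * Q n z) = 0) \<longrightarrow> (\<forall>n<N. l n = 0))"

text \<open>Restricting the relation to \<open>W\<close>, where \<open>p\<close> vanishes, leaves
  only the terms with exponent 0, whose coefficients are zero by independence on \<open>W\<close>.
  The remaining relation is divisible by \<open>p\<close>, which cancels because \<open>Z\<close> is
  irreducible and \<open>p\<close> is not zero on it.\<close>

lemma indep_on_powers:
  assumes Z: "zirreducible Z" "W \<subseteq> Z" and Q: "indep_on W N Q" "\<And>n. n < N \<Longrightarrow> Q n \<in> poly_funs"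
    and p: "p \<in> poly_funs" "\<forall>w\<in>W. p w = 0" "\<exists>z\<in>Z. p z \<noteq> 0"
  shows "(\<forall>z\<in>Z. (\<Sum>j<M. p z ^ j * (\<Sum>i<N. a j i * Q i z)) = 0) \<Longrightarrow> j < M \<Longrightarrow> i < N \<Longrightarrow> a j i = 0"
proof (induction M arbitrary: a j)
  case 0
  then show ?case by simp
next
  case (Suc M)
  define S where "S z = (\<Sum>j<M. p z ^ j * (\<Sum>i<N. a (Suc j) i * Q i z))" for z
  have split: "(\<Sum>i<N. a 0 i * Q i z) + p z * S z = 0" if "z \<in> Z" for z
    using Suc.prems(1) that unfolding S_def
    by (simp add: sum.lessThan_Suc_shift sum_distrib_left mult.assoc del: sum.lessThan_Suc)
  have "\<forall>z\<in>W. (\<Sum>i<N. a 0 i * Q i z) = 0" using split p(2) Z(2) by force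
  then have a0: "\<forall>i<N. a 0 i = 0" using Q(1) unfolding indep_on_def by blast
  then have "\<forall>z\<in>Z. p z * S z = 0" using split by simp
  moreover have "S \<in> poly_funs" unfolding S_def using p(1) Q(2) by (intro poly_funs_intros) auto
  ultimately have "\<forall>z\<in>Z. S z = 0" using zirreducible_prime[OF Z(1) p(1)] p(3) by blast
  then have "a (Suc j) i = 0" if "j < M" for j
    using Suc.IH[of "\<lambda>j. a (Suc j)"] that Suc.prems(3) unfolding S_def by blast
  with a0 Suc.prems show ?case by (cases j) auto
qed

text \<open>The index \<open>n\<close> encodes a pair: \<open>n mod N\<close> selects the factor
  from \<open>Q\<close>, and \<open>n div N\<close> is the exponent of \<open>p\<close>.\<close>

lemma indep_on_step:
  assumes Z: "zirreducible Z" "W \<subseteq> Z" and Q: "indep_on W N Q" "\<And>n. n < N \<Longrightarrow> Q n \<in> poly_funs"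
    and p: "p \<in> poly_funs" "\<forall>w\<in>W. p w = 0" "\<exists>z\<in>Z. p z \<noteq> 0"
  shows "indep_on Z (M * N) (\<lambda>n z. Q (n mod N) z * p z ^ (n div N))"
  unfolding indep_on_def
proof (intro allI impI)
  fix l n assume zero: "\<forall>z\<in>Z. (\<Sum>n<M * N. l n * (Q (n mod N) z * p z ^ (n div N))) = 0" and n: "n < M * N"
  then have N: "N > 0" by (cases N) auto
  have "(\<Sum>j<M. p z ^ j * (\<Sum>i<N. l (i + j * N) * Q i z)) = 0" if "z \<in> Z" for z
  proof -
    have "(\<Sum>j<M. p z ^ j * (\<Sum>i<N. l (i + j * N) * Q i z))
        = (\<Sum>j<M. \<Sum>i<N. l (i + j * N) * (Q ((i + j * N) mod N) z * p z ^ ((i + j * N) div N)))"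
      unfolding sum_distrib_left by (intro sum.cong refl) (simp add: mult_ac)
    also have "\<dots> = (\<Sum>j<M. \<Sum>n = j * N..<j * N + N. l n * (Q (n mod N) z * p z ^ (n div N)))"
    proof (rule sum.cong[OF refl])
      fix j
      show "(\<Sum>i<N. l (i + j * N) * (Q ((i + j * N) mod N) z * p z ^ ((i + j * N) div N)))
          = (\<Sum>n = j * N..<j * N + N. l n * (Q (n mod N) z * p z ^ (n div N)))"
        using sum.shift_bounds_nat_ivl[of "\<lambda>n. l n * (Q (n mod N) z * p z ^ (n div N))" 0 "j * N" N]
        by (simp add: atLeast0LessThan add.commute)
    qed
    also have "\<dots> = (\<Sum>n<M * N. l n * (Q (n mod N) z * p z ^ (n div N)))"
      by (rule sum.nat_group)
    finally show ?thesis using zero that by simp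
  qed
  then have "l (n mod N + n div N * N) = 0"
    using indep_on_powers[OF assms, where M = M and a = "\<lambda>j i. l (i + j * N)" and j = "n div N" and i = "n mod N"] n N
    by (simp add: less_mult_imp_div_less)
  then show "l n = 0" by simp
qed

text \<open>Each inclusion contributes one polynomial that vanishes on the smaller set but not on
  the larger, used with exponents below \<open>M\<close>. The quantifier order matters:
  \<open>e\<close> is the sum of the degrees of these polynomials and does not depend on
  \<open>M\<close>.\<close>

lemma indep_on_chain:
  fixes Z :: "nat \<Rightarrow> sc set"
  assumes "\<forall>i\<le>n. zirreducible (Z i)" "\<forall>i<n. Z i \<subset> Z (Suc i)"
  shows "\<exists>e. \<forall>M. \<exists>Q. indep_on (Z n) (M ^ n) Q \<and> (\<forall>i<M ^ n. Q i \<in> poly_funs \<and> pullback_deg c (e * M) (Q i))"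
  using assms
proof (induction n)
  case 0
  then obtain z where "z \<in> Z 0" unfolding zirreducible_def by blast
  then have "indep_on (Z 0) (M ^ 0) (\<lambda>_ _. 1)" for M :: nat by (auto simp: indep_on_def)
  then show ?case by (auto intro!: exI[of _ 0] exI[of _ "\<lambda>_ _. 1"] pconst pullback_deg_const)
next
  case (Suc n)
  then obtain e where e: "\<And>M. \<exists>Q. indep_on (Z n) (M ^ n) Q \<and>
      (\<forall>i<M ^ n. Q i \<in> poly_funs \<and> pullback_deg c (e * M) (Q i))" by auto
  have sub: "Z n \<subset> Z (Suc n)" and irr: "zirreducible (Z n)" "zirreducible (Z (Suc n))" using Suc.prems by auto
  then obtain z where "z \<in> Z (Suc n)" "z \<notin> Z n" by blast
  then obtain p where p: "p \<in> poly_funs" "\<forall>w\<in>Z n. p w = 0" "\<exists>z\<in>Z (Suc n). p z \<noteq> 0"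
  proof -
    have "\<exists>p\<in>poly_funs. (\<forall>w\<in>Z n. p w = 0) \<and> p z \<noteq> 0"
      using irr(1) \<open>z \<notin> Z n\<close> unfolding zirreducible_def zclosed_iff_separated[of "Z n"] by simp
    then show ?thesis using that \<open>z \<in> Z (Suc n)\<close> by (elim bexE conjE) (metis (no_types))
  qed
  obtain d where d: "pullback_deg c d p" using pullback_deg_exists[OF p(1)] by blast
  have "\<exists>Q. indep_on (Z (Suc n)) (M ^ Suc n) Q \<and>
      (\<forall>i<M ^ Suc n. Q i \<in> poly_funs \<and> pullback_deg c ((e + d) * M) (Q i))" for M
  proof -
    obtain Q where Q: "indep_on (Z n) (M ^ n) Q"
      "\<And>i. i < M ^ n \<Longrightarrow> Q i \<in> poly_funs" "\<And>i. i < M ^ n \<Longrightarrow> pullback_deg c (e * M) (Q i)"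
      using e[of M] by blast
    let ?Q = "\<lambda>i z. Q (i mod M ^ n) z * p z ^ (i div M ^ n)"
    have "indep_on (Z (Suc n)) (M * M ^ n) ?Q"
      using indep_on_step[OF irr(2) _ Q(1,2) p] sub by blast
    moreover have "?Q i \<in> poly_funs \<and> pullback_deg c ((e + d) * M) (?Q i)" if "i < M * M ^ n" for i
    proof -
      have "M ^ n > 0" using that by (cases "M ^ n") auto
      then have i: "i mod M ^ n < M ^ n" "i div M ^ n < M"
        using that by (auto intro: less_mult_imp_div_less)
      have "pullback_deg c (e * M + d * (i div M ^ n)) (?Q i)"
        by (rule pullback_deg_mult[OF Q(3)[OF i(1)] pullback_deg_power[OF d]])
      then have "pullback_deg c ((e + d) * M) (?Q i)"
        using i(2) by (elim pullback_deg_mono) (simp add: add_mult_distrib less_imp_le)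
      then show ?thesis using Q(2)[OF i(1)] p(1) by (intro conjI pmult poly_funs_power)
    qed
    ultimately show ?thesis by auto
  qed
  then show ?case by blast
qed

lemma no_long_chain:
  fixes Z :: "nat \<Rightarrow> sc set"
  assumes "\<forall>i\<le>6. zirreducible (Z i)" "\<forall>i<6. Z i \<subset> Z (Suc i)" "Z 6 \<subseteq> zclosure (orbit c)"
  shows False
proof -
  obtain e where e: "\<And>M. \<exists>Q. indep_on (Z 6) (M ^ 6) Q \<and>
      (\<forall>i<M ^ 6. Q i \<in> poly_funs \<and> pullback_deg c (e * M) (Q i))"
    using indep_on_chain[OF assms(1,2)] by blast
  \<comment> \<open>\<open>M\<close> exceeds \<open>(6 * e + 1) ^ 5\<close>, so that
    \<open>(6 * (e * M) + 1) ^ 5 \<le> (6 * e + 1) ^ 5 * M ^ 5 < M ^ 6\<close>.\<close>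
  define M where "M = (6 * e + 1) ^ 5 + 1"
  obtain Q where Q: "indep_on (Z 6) (M ^ 6) Q" "\<And>i. i < M ^ 6 \<Longrightarrow> Q i \<in> poly_funs"
      "\<And>i. i < M ^ 6 \<Longrightarrow> pullback_deg c (e * M) (Q i)" using e[of M] by blast
  then obtain F where F: "\<And>i. i < M ^ 6 \<Longrightarrow> Pol (6 * (e * M)) (F i)"
      "\<And>i x. i < M ^ 6 \<Longrightarrow> pdet x \<noteq> 0 \<Longrightarrow> F i x = Q i (pact c x) * pdet x ^ (2 * (e * M))"
    unfolding pullback_deg_def by metis
  have "(6 * (e * M) + 1) ^ 5 \<le> ((6 * e + 1) * M) ^ 5"
    by (intro power_mono) (simp_all add: M_def)
  also have "\<dots> = (6 * e + 1) ^ 5 * M ^ 5" by (rule power_mult_distrib)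
  also have "\<dots> < M * M ^ 5" by (intro mult_strict_right_mono) (simp_all add: M_def)
  finally have "(6 * (e * M) + 1) ^ 5 < M ^ 6" by (simp add: power_Suc[symmetric] del: power_Suc)
  from Pol_linear_relation[OF F(1) this] obtain l
    where "(\<exists>n<M ^ 6. l n \<noteq> 0) \<and> (\<forall>x. (\<Sum>n<M ^ 6. l n * F n x) = 0)" by (rule exE)
  then have l: "\<exists>n<M ^ 6. l n \<noteq> 0" "\<And>x. (\<Sum>n<M ^ 6. l n * F n x) = 0" by simp_all
  have "(\<Sum>n<M ^ 6. l n * Q n z) = 0" if z: "z \<in> orbit c" for z
  proof -
    obtain x where x: "pdet x \<noteq> 0" "z = pact c x" using z unfolding orbit_pact by blast
    \<comment> \<open>All \<open>Q n\<close> share one degree bound, hence are cleared by the same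
      power of \<open>pdet\<close>, and the linear relation survives.\<close>
    have "(\<Sum>n<M ^ 6. l n * Q n z) * pdet x ^ (2 * (e * M)) = (\<Sum>n<M ^ 6. l n * F n x)"
      unfolding sum_distrib_right by (intro sum.cong refl) (simp add: F(2) x)
    then show ?thesis using l(2) x(1) by simp
  qed
  moreover have "(\<lambda>z. \<Sum>n<M ^ 6. l n * Q n z) \<in> poly_funs"
    using Q(2) by (intro poly_funs_intros) auto
  ultimately have "zclosure (orbit c) \<subseteq> {z. (\<Sum>n<M ^ 6. l n * Q n z) = 0}"
    by (intro zclosure_minimal zclosed_zeros) auto
  then have "\<forall>z\<in>Z 6. (\<Sum>n<M ^ 6. l n * Q n z) = 0" using assms(3) by auto
  then show False using Q(1) l(1) unfolding indep_on_def by blast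
qed

lemma zdim_orbit_le: "zdim (zclosure (orbit c)) \<le> 5"
  unfolding zdim_def
proof (rule Sup_least, clarify)
  fix n and Z :: "nat \<Rightarrow> sc set"
  assume Z: "\<forall>i\<le>n. zirreducible (Z i)" "\<forall>i<n. Z i \<subset> Z (Suc i)" "Z n \<subseteq> zclosure (orbit c)"
  have "n \<le> 5"
  proof (rule ccontr)
    assume n: "\<not> n \<le> 5"
    have "Z 6 \<subseteq> Z (6 + k)" if "6 + k \<le> n" for k
      using that
    proof (induction k)
      case (Suc k)
      then have "Z (6 + k) \<subset> Z (Suc (6 + k))" by (intro Z(2)[rule_format]) simp
      moreover have "Z 6 \<subseteq> Z (6 + k)" using Suc by simp
      ultimately show ?case by auto
    qed simp
    from this[of "n - 6"] n have "Z 6 \<subseteq> Z n" by simp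
    then have "Z 6 \<subseteq> zclosure (orbit c)" using Z(3) by (rule order_trans)
    with no_long_chain[of Z c] Z n show False by simp
  qed
  then have "enat n \<le> enat 5" by simp
  then show "enat n \<le> 5" by (simp add: numeral_eq_enat)
qed

text \<open>Starting from the identity, the group parameters are freed one at a time in the order
  \<open>x 4\<close>, \<open>x 0\<close>, \<open>x 3\<close>, \<open>x 2\<close>,
  \<open>x 1\<close>. Each inclusion is strict because \<open>p k\<close> vanishes on the image of
  \<open>L k\<close> but not at the image of the point \<open>y k\<close> of
  \<open>L (Suc k)\<close>.\<close>

lemma zdim_orbit_R03: "zdim (zclosure (orbit R03)) = 5"
proof (rule antisym[OF zdim_orbit_le])
  define L :: "nat \<Rightarrow> (nat \<Rightarrow> complex) set" where
    "L k = {x. (k < 1 \<longrightarrow> x 4 = 1) \<and> (k < 2 \<longrightarrow> x 0 = 1) \<and> (k < 3 \<longrightarrow> x 3 = 1) \<and>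
      (k < 4 \<longrightarrow> x 2 = 0) \<and> (k < 5 \<longrightarrow> x 1 = 0)}" for k
  define Z where "Z k = zclosure (pact R03 ` {x \<in> L k. pdet x \<noteq> 0})" for k
  define p :: "nat \<Rightarrow> sc \<Rightarrow> complex" where
    "p k = [\<lambda>c. c f1 f1 e1 - 1, \<lambda>c. c e1 f1 f1 - 1, \<lambda>c. c e2 e2 e2 - 1, \<lambda>c. c e2 f1 f1, \<lambda>c. c f1 f1 e2] ! k"
    for k
  define y :: "nat \<Rightarrow> nat \<Rightarrow> complex" where
    "y k = nth ([[1, 0, 0, 1, 2], [2, 0, 0, 1, 1], [1, 0, 0, 2, 1], [1, 0, 1, 1, 1], [1, 1, 0, 1, 1]] ! k)" for k
  have k5: "k = 0 \<or> k = 1 \<or> k = 2 \<or> k = 3 \<or> k = 4" if "k < 5" for k :: nat using that by auto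
  have irr: "zirreducible (Z k)" for k
    unfolding Z_def
    by (rule zirreducible_pact_image[of "\<lambda>i. of_bool (i = 0 \<or> i = 3 \<or> i = 4)"])
      (auto simp: L_def pdet_def)
  have "Z k \<subset> Z (Suc k)" if k: "k < 5" for k
    unfolding less_le_not_le
  proof
    show "Z k \<subseteq> Z (Suc k)"
      unfolding Z_def
      by (rule zclosure_minimal[OF _ zclosed_zclosure], rule order_trans[OF _ zclosure_subset])
        (auto simp: L_def)
    have p: "p k \<in> poly_funs"
      using k5[OF k] by (elim disjE) (simp_all add: p_def poly_funs_intros)
    have "p k (pact R03 x) = 0" if "x \<in> L k" "pdet x \<noteq> 0" for x
      using k5[OF k] that
      by (elim disjE) (auto simp: p_def L_def pact_def act_def sum_idx gmat_def gmat_inv_def R03_def mk_def pdet_def field_simps)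
    then have "Z k \<subseteq> {c. p k c = 0}"
      unfolding Z_def by (intro zclosure_minimal zclosed_zeros p) auto
    moreover have "pact R03 (y k) \<in> Z (Suc k)"
      unfolding Z_def using k5[OF k] zclosure_subset
      by (intro subsetD[OF zclosure_subset] imageI) (auto simp: y_def L_def pdet_def)
    moreover have "p k (pact R03 (y k)) \<noteq> 0"
      using k5[OF k]
      by (elim disjE) (auto simp: p_def y_def pact_def act_def sum_idx gmat_def gmat_inv_def R03_def mk_def)
    ultimately show "\<not> Z (Suc k) \<subseteq> Z k" by blast
  qed
  moreover have "Z 5 \<subseteq> zclosure (orbit R03)"
    unfolding Z_def orbit_pact
    by (rule zclosure_minimal[OF _ zclosed_zclosure], rule order_trans[OF _ zclosure_subset]) auto
  ultimately have "enat 5 \<le> zdim (zclosure (orbit R03))"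
    unfolding zdim_def using irr by (intro Sup_upper) blast
  then show "5 \<le> zdim (zclosure (orbit R03))" by (simp add: numeral_eq_enat)
qed

section \<open>The variety in coordinates\<close>

definition assoc_sc :: "sc \<Rightarrow> idx \<Rightarrow> idx \<Rightarrow> idx \<Rightarrow> idx \<Rightarrow> complex" where
  "assoc_sc c i j l k = (\<Sum>m\<in>UNIV. c i j m * c m l k - c j l m * c i m k)"

lemma mult_nested: "mult c x y k = (\<Sum>i\<in>UNIV. x i * (\<Sum>j\<in>UNIV. y j * c i j k))"
  by (simp only: mult_def sum_distrib_left mult.assoc)

lemma sum_pull_coeffs:
  "(\<Sum>m\<in>UNIV. (\<Sum>j\<in>UNIV. y j * (\<Sum>l\<in>UNIV. z l * F j l m)) * G m)
    = (\<Sum>j\<in>UNIV. y j * (\<Sum>l\<in>UNIV. z l * (\<Sum>m\<in>UNIV. F j l m * G m)))"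
  for F :: "idx \<Rightarrow> idx \<Rightarrow> idx \<Rightarrow> complex"
proof -
  have "(\<Sum>m\<in>UNIV. (\<Sum>j\<in>UNIV. y j * (\<Sum>l\<in>UNIV. z l * F j l m)) * G m)
      = (\<Sum>m\<in>UNIV. G m * (\<Sum>j\<in>UNIV. y j * (\<Sum>l\<in>UNIV. z l * F j l m)))"
    by (simp only: mult.commute)
  also have "\<dots> = (\<Sum>j\<in>UNIV. y j * (\<Sum>l\<in>UNIV. z l * (\<Sum>m\<in>UNIV. G m * F j l m)))"
    by (simp only: sum_swap_scaled[of G])
  finally show ?thesis by (simp only: mult.commute)
qed

lemma assoc_expand:
  "assoc c x y z k = (\<Sum>i\<in>UNIV. x i * (\<Sum>j\<in>UNIV. y j * (\<Sum>l\<in>UNIV. z l * assoc_sc c i j l k)))"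
proof -
  have "mult c (mult c x y) z k =
      (\<Sum>m\<in>UNIV. (\<Sum>i\<in>UNIV. x i * (\<Sum>j\<in>UNIV. y j * c i j m)) * (\<Sum>l\<in>UNIV. z l * c m l k))"
    by (simp only: mult_nested)
  also have "\<dots> = (\<Sum>i\<in>UNIV. x i * (\<Sum>j\<in>UNIV. y j * (\<Sum>m\<in>UNIV. c i j m * (\<Sum>l\<in>UNIV. z l * c m l k))))"
    by (rule sum_pull_coeffs)
  also have "\<dots> = (\<Sum>i\<in>UNIV. x i * (\<Sum>j\<in>UNIV. y j * (\<Sum>l\<in>UNIV. z l * (\<Sum>m\<in>UNIV. c i j m * c m l k))))"
    by (simp only: sum_swap_scaled[of "\<lambda>m. c _ _ m"])
  finally have left: "mult c (mult c x y) z k =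
    (\<Sum>i\<in>UNIV. x i * (\<Sum>j\<in>UNIV. y j * (\<Sum>l\<in>UNIV. z l * (\<Sum>m\<in>UNIV. c i j m * c m l k))))" .
  have right: "mult c x (mult c y z) k =
      (\<Sum>i\<in>UNIV. x i * (\<Sum>j\<in>UNIV. y j * (\<Sum>l\<in>UNIV. z l * (\<Sum>m\<in>UNIV. c j l m * c i m k))))"
    by (simp only: mult_nested sum_pull_coeffs)
  show ?thesis
    unfolding assoc_def left right assoc_sc_def
    by (simp add: sum_subtractf right_diff_distrib)
qed

text \<open>The identities are trilinear, so basis triples suffice. This finite system of equations
  shows that the variety is closed and makes membership a case check.\<close>

definition variety_eqs :: "sc \<Rightarrow> bool" where
  "variety_eqs c \<longleftrightarrow> (\<forall>i j l k.
     (deg k \<noteq> (deg i + deg j) mod 2 \<longrightarrow> c i j k = 0) \<and>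
     assoc_sc c i j l k = - ((-1) ^ (deg j * deg l)) * assoc_sc c i l j k \<and>
     assoc_sc c i j l k + (-1) ^ (deg i * deg j + deg i * deg l) * assoc_sc c j l i k
       + (-1) ^ (deg l * deg j + deg i * deg l) * assoc_sc c l i j k = 0)"

lemma deg_01: "deg i \<in> {0, 1}"
  by (cases i) simp_all

lemma homog_basis: "homog (deg i) (basis i)"
  by (auto simp: homog_def basis_def)

lemma assoc_basis: "assoc c (basis i) (basis j) (basis l) k = assoc_sc c i j l k"
proof -
  have "(\<Sum>a\<in>UNIV. basis i a * F a) = F i" for i and F :: "idx \<Rightarrow> complex"
    by (cases i) (simp_all add: basis_def sum_idx)
  then show ?thesis by (simp add: assoc_expand)
qed

text \<open>The signs in the identities depend on degrees, which are constant along the support of a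
  homogeneous vector; this allows fixed signs to replace those attached to basis indices.\<close>

lemma homog_sum:
  assumes "homog d x" "\<And>i. deg i = d \<Longrightarrow> F i = G i"
  shows "(\<Sum>i\<in>UNIV. x i * F i) = (\<Sum>i\<in>UNIV. x i * (G i :: complex))"
  using assms by (intro sum.cong refl) (auto simp: homog_def)

lemma variety_eqs_right_alternative:
  assumes "variety_eqs c"
  shows "right_alternative c"
  unfolding right_alternative_def
proof (intro ballI allI impI ext)
  fix dx dy dz x y z k
  assume h: "homog dx x \<and> homog dy y \<and> homog dz z"
  have "assoc c x y z k = (\<Sum>i\<in>UNIV. x i * (\<Sum>j\<in>UNIV. y j * (\<Sum>l\<in>UNIV. z l *
      (- ((-1) ^ (dy * dz)) * assoc_sc c i l j k))))"
    unfolding assoc_expand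
  proof (intro homog_sum)
    show "homog dx x" "homog dy y" "homog dz z" using h by auto
    fix i j l assume "deg i = dx" "deg j = dy" "deg l = dz"
    then show "assoc_sc c i j l k = - ((-1) ^ (dy * dz)) * assoc_sc c i l j k"
      using assms unfolding variety_eqs_def by blast
  qed
  also have "\<dots> = - ((-1) ^ (dy * dz)) * (\<Sum>i\<in>UNIV. x i * (\<Sum>j\<in>UNIV. y j * (\<Sum>l\<in>UNIV. z l * assoc_sc c i l j k)))"
    by (simp add: sum_distrib_left mult_ac)
  also have "(\<Sum>i\<in>UNIV. x i * (\<Sum>j\<in>UNIV. y j * (\<Sum>l\<in>UNIV. z l * assoc_sc c i l j k))) = assoc c x z y k"
    unfolding assoc_expand by (simp only: sum_swap_scaled[of y])
  finally show "assoc c x y z k = - ((-1) ^ (dy * dz)) * assoc c x z y k" .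
qed

lemma variety_eqs_minus11:
  assumes "variety_eqs c"
  shows "minus11_identity c"
  unfolding minus11_identity_def
proof (intro ballI allI impI)
  fix dx dy dz x y z k
  assume h: "homog dx x \<and> homog dy y \<and> homog dz z"
  have yzx: "assoc c y z x k = (\<Sum>i\<in>UNIV. x i * (\<Sum>j\<in>UNIV. y j * (\<Sum>l\<in>UNIV. z l * assoc_sc c j l i k)))"
    unfolding assoc_expand by (simp only: sum_swap_scaled[of _ x])
  have zxy: "assoc c z x y k = (\<Sum>i\<in>UNIV. x i * (\<Sum>j\<in>UNIV. y j * (\<Sum>l\<in>UNIV. z l * assoc_sc c l i j k)))"
    unfolding assoc_expand by (simp only: sum_swap_scaled[of z])
  have "assoc c x y z k + (-1) ^ (dx * dy + dx * dz) * assoc c y z x k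
      + (-1) ^ (dz * dy + dx * dz) * assoc c z x y k
    = (\<Sum>i\<in>UNIV. x i * (\<Sum>j\<in>UNIV. y j * (\<Sum>l\<in>UNIV. z l * (assoc_sc c i j l k
        + (-1) ^ (dx * dy + dx * dz) * assoc_sc c j l i k + (-1) ^ (dz * dy + dx * dz) * assoc_sc c l i j k))))"
    unfolding yzx zxy assoc_expand[of c x y z]
    by (simp add: sum_distrib_left sum.distrib distrib_left mult_ac)
  also have "\<dots> = (\<Sum>i\<in>UNIV. x i * (\<Sum>j\<in>UNIV. y j * (\<Sum>l\<in>UNIV. z l * 0)))"
  proof (intro homog_sum)
    show "homog dx x" "homog dy y" "homog dz z" using h by auto
    fix i j l assume "deg i = dx" "deg j = dy" "deg l = dz"
    then show "assoc_sc c i j l k + (-1) ^ (dx * dy + dx * dz) * assoc_sc c j l i k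
        + (-1) ^ (dz * dy + dx * dz) * assoc_sc c l i j k = 0"
      using assms unfolding variety_eqs_def by blast
  qed
  finally show "assoc c x y z k + (-1) ^ (dx * dy + dx * dz) * assoc c y z x k
      + (-1) ^ (dz * dy + dx * dz) * assoc c z x y k = 0" by simp
qed

lemma minus11_variety_iff: "c \<in> minus11_variety \<longleftrightarrow> variety_eqs c"
proof
  assume "variety_eqs c"
  then show "c \<in> minus11_variety"
    using variety_eqs_right_alternative[of c] variety_eqs_minus11[of c]
    by (simp add: minus11_variety_def even_sc_def) (simp add: variety_eqs_def)
next
  assume c: "c \<in> minus11_variety"
  show "variety_eqs c"
    unfolding variety_eqs_def
  proof (intro allI conjI)
    fix i j l k
    note homog_basis[of i] homog_basis[of j] homog_basis[of l]
    show "assoc_sc c i j l k = - ((-1) ^ (deg j * deg l)) * assoc_sc c i l j k"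
    proof -
      have "assoc c (basis i) (basis j) (basis l) =
          (\<lambda>k. - ((-1) ^ (deg j * deg l)) * assoc c (basis i) (basis l) (basis j) k)"
        using c deg_01 homog_basis unfolding minus11_variety_def right_alternative_def by blast
      from fun_cong[OF this, of k] show ?thesis by (simp only: assoc_basis)
    qed
    show "assoc_sc c i j l k + (-1) ^ (deg i * deg j + deg i * deg l) * assoc_sc c j l i k
       + (-1) ^ (deg l * deg j + deg i * deg l) * assoc_sc c l i j k = 0"
    proof -
      have "\<forall>k. assoc c (basis i) (basis j) (basis l) k
          + (-1) ^ (deg i * deg j + deg i * deg l) * assoc c (basis j) (basis l) (basis i) k
          + (-1) ^ (deg l * deg j + deg i * deg l) * assoc c (basis l) (basis i) (basis j) k = 0"
        using c deg_01 homog_basis unfolding minus11_variety_def minus11_identity_def by blast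
      then show ?thesis by (simp only: assoc_basis)
    qed
  qed (use c in \<open>auto simp: minus11_variety_def even_sc_def\<close>)
qed

lemma zclosed_minus11_variety: "zclosed minus11_variety"
proof -
  have *: "minus11_variety = {c. variety_eqs c}" using minus11_variety_iff by blast
  show ?thesis
    unfolding * variety_eqs_def assoc_sc_def
    by (intro zclosed_all zclosed_conj zclosed_imp zclosed_eq poly_funs_intros)
qed

section \<open>Invariance of the variety under the group\<close>

lemma homog_app:
  assumes "gl_even g h" "homog d x"
  shows "homog d (app g x)"
  using assms unfolding homog_def app_def gl_even_def
  by (auto intro!: sum.neutral) metis

lemma app_scale: "app g (\<lambda>k. a * x k) = (\<lambda>k. a * app g x k)"
  by (auto simp: app_def sum_distrib_left mult_ac)

lemma app_add: "app g (\<lambda>k. x k + y k) = (\<lambda>k. app g x k + app g y k)"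
  by (auto simp: app_def sum.distrib distrib_left)

lemma app_diff: "app g (\<lambda>k. x k - y k) = (\<lambda>k. app g x k - app g y k)"
  by (auto simp: app_def sum_subtractf right_diff_distrib)

lemma app_app: "gl_even g h \<Longrightarrow> app g (app h x) = x" "gl_even g h \<Longrightarrow> app h (app g x) = x"
  using app_mcomp[of g h x] app_mcomp[of h g x] by (simp_all add: gl_even_iff app_idm)

lemma assoc_act:
  assumes "gl_even g h"
  shows "assoc (act g h c) x y z = app g (assoc c (app h x) (app h y) (app h z))"
  unfolding assoc_def app_diff by (simp add: mult_act app_app[OF assms])

lemma act_in_variety:
  assumes g: "gl_even g h" and c: "c \<in> minus11_variety"
  shows "act g h c \<in> minus11_variety"
proof -
  have hom: "homog d (app h x)" if "homog d x" for d x
    using homog_app[OF gl_even_sym[OF g] that] .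
  have "even_sc (act g h c)"
    unfolding even_sc_def
  proof (intro allI impI)
    fix i j k assume ijk: "deg k \<noteq> (deg i + deg j) mod 2"
    have "homog ((deg i + deg j) mod 2) (mult c (app h (basis i)) (app h (basis j)))"
      unfolding homog_def
    proof (intro allI impI)
      fix k assume k: "deg k \<noteq> (deg i + deg j) mod 2"
      have "app h (basis i) a * app h (basis j) b * c a b k = 0" for a b
        using hom[OF homog_basis, of i] hom[OF homog_basis, of j] c k
        unfolding homog_def minus11_variety_def even_sc_def by (cases "deg a = deg i \<and> deg b = deg j") auto
      then show "mult c (app h (basis i)) (app h (basis j)) k = 0"
        unfolding mult_def by (intro sum.neutral ballI)
    qed
    from homog_app[OF g this] have "homog ((deg i + deg j) mod 2) (act g h c i j)"
      by (simp add: mult_act[symmetric] mult_basis)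
    with ijk show "act g h c i j k = 0" unfolding homog_def by blast
  qed
  moreover have "right_alternative (act g h c)"
    unfolding right_alternative_def
  proof (intro ballI allI impI)
    fix dx dy dz :: nat and x y z assume d: "dx \<in> {0,1}" "dy \<in> {0,1}" "dz \<in> {0,1}"
      and xyz: "homog dx x \<and> homog dy y \<and> homog dz z"
    have "assoc c (app h x) (app h y) (app h z) =
        (\<lambda>k. - ((-1) ^ (dy * dz)) * assoc c (app h x) (app h z) (app h y) k)"
      using c d xyz hom unfolding minus11_variety_def right_alternative_def by blast
    then show "assoc (act g h c) x y z = (\<lambda>k. - ((-1) ^ (dy * dz)) * assoc (act g h c) x z y k)"
      unfolding assoc_act[OF g] by (simp only: app_scale)
  qed
  moreover have "minus11_identity (act g h c)"
    unfolding minus11_identity_def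
  proof (intro ballI allI impI)
    fix dx dy dz :: nat and x y z k assume d: "dx \<in> {0,1}" "dy \<in> {0,1}" "dz \<in> {0,1}"
      and xyz: "homog dx x \<and> homog dy y \<and> homog dz z"
    let ?x = "app h x" and ?y = "app h y" and ?z = "app h z"
    have *: "homog dx ?x \<and> homog dy ?y \<and> homog dz ?z" using hom xyz by blast
    have "(\<lambda>k. assoc c ?x ?y ?z k + (-1) ^ (dx * dy + dx * dz) * assoc c ?y ?z ?x k
        + (-1) ^ (dz * dy + dx * dz) * assoc c ?z ?x ?y k) = (\<lambda>k. 0)"
      using c d * unfolding minus11_variety_def minus11_identity_def by auto
    then have "app g (\<lambda>k. assoc c ?x ?y ?z k + (-1) ^ (dx * dy + dx * dz) * assoc c ?y ?z ?x k
        + (-1) ^ (dz * dy + dx * dz) * assoc c ?z ?x ?y k) k = 0"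
      by (simp add: app_def)
    then show "assoc (act g h c) x y z k + (-1) ^ (dx * dy + dx * dz) * assoc (act g h c) y z x k
        + (-1) ^ (dz * dy + dx * dz) * assoc (act g h c) z x y k = 0"
      unfolding assoc_act[OF g] by (simp only: app_scale app_add)
  qed
  ultimately show ?thesis by (simp add: minus11_variety_def)
qed

section \<open>The thirteen representatives and a criterion for rigidity\<close>

lemma R_variety_eqs:
  "variety_eqs R01" "variety_eqs R03" "variety_eqs R04" "variety_eqs R05" "variety_eqs R07"
  "variety_eqs R23" "variety_eqs R25" "variety_eqs R26" "variety_eqs R29" "variety_eqs R31"
  "variety_eqs R32" "variety_eqs R33" "variety_eqs R36"
  unfolding variety_eqs_def R01_def R03_def R04_def R05_def R07_def R23_def R25_def R26_def
    R29_def R31_def R32_def R33_def R36_def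
  by (intro allI; case_tac i; case_tac j; case_tac l; case_tac k; simp add: mk_def assoc_sc_def sum_idx)+

lemma R_list_in_variety: "set R_list \<subseteq> minus11_variety"
  using R_variety_eqs by (simp add: R_list_def minus11_variety_iff)

lemma orbit_subset_variety: "c \<in> minus11_variety \<Longrightarrow> orbit c \<subseteq> minus11_variety"
  unfolding orbit_def using act_in_variety by blast

lemma zclosure_orbit_subset_variety:
  "c \<in> minus11_variety \<Longrightarrow> zclosure (orbit c) \<subseteq> minus11_variety"
  by (intro zclosure_minimal orbit_subset_variety zclosed_minus11_variety)

text \<open>The translates of an open neighbourhood of the base point cover its orbit.\<close>

lemma rigid_via_neighbourhood:
  assumes c0: "c0 \<in> minus11_variety" "c0 \<notin> D" and D: "zclosed D"
    and nbhd: "minus11_variety - D \<subseteq> orbit c0"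
  shows "rigid_in minus11_variety c0"
proof -
  define Z where "Z = {c. \<forall>g h. gl_even g h \<longrightarrow> act g h c \<in> D}"
  have "zclosed Z"
    unfolding Z_def by (intro zclosed_all zclosed_imp zclosed_act D)
  moreover have "orbit c0 = minus11_variety - Z"
  proof (intro equalityI subsetI)
    fix c assume c: "c \<in> orbit c0"
    then obtain g h where gh: "gl_even g h" "c = act g h c0" unfolding orbit_def by blast
    then have "act h g c \<notin> D" using act_inverse c0(2) by simp
    then have "c \<notin> Z" using gl_even_sym[OF gh(1)] unfolding Z_def by blast
    then show "c \<in> minus11_variety - Z" using c orbit_subset_variety[OF c0(1)] by blast
  next
    fix c assume c: "c \<in> minus11_variety - Z"
    then obtain g h where gh: "gl_even g h" "act g h c \<notin> D" unfolding Z_def by blast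
    then have "act g h c \<in> orbit c0" using nbhd act_in_variety c by blast
    from act_in_orbit[OF gl_even_sym[OF gh(1)] this] show "c \<in> orbit c0"
      by (simp add: act_inverse[OF gh(1)])
  qed
  ultimately show ?thesis unfolding rigid_in_def by blast
qed

text \<open>\<open>tab\<close> says that the columns of \<open>g\<close>, taken as a new basis of
  \<open>K\<close>, have the multiplication table \<open>R\<close>; in this form the inverse matrix
  stays out of the calculation.\<close>

lemma orbitI:
  assumes g: "gl_even g h"
    and tab: "\<And>i j. mult K (\<lambda>a. g a i) (\<lambda>a. g a j) = app g (R i j)"
  shows "K \<in> orbit R"
proof -
  have col: "app g (basis i) = (\<lambda>a. g a i)" for i
    by (cases i) (simp_all add: app_def basis_def sum_idx)
  have "act h g K i j = R i j" for i j
    using mult_act[of h g K "basis i" "basis j"] tab[of i j]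
    by (simp add: mult_basis col app_app[OF g])
  then have "act h g K = R" by blast
  then have "R \<in> orbit K" unfolding orbit_def using gl_even_sym[OF g] by blast
  then show ?thesis by (rule orbit_sym)
qed

section \<open>Cyclic algebras\<close>

text \<open>The even part is generated by \<open>v = e1\<close> with basis \<open>v, v\<^sup>2\<close> and
  \<open>v (v - r) (v - s) = 0\<close>; \<open>a\<close> and \<open>b\<close> are the eigenvalues of the
  left and right multiplication by \<open>v\<close> on the odd part, and the square of \<open>f1\<close> is
  \<open>t (v\<^sup>2 + (a - r - s) v)\<close>.\<close>

definition cyc :: "complex \<Rightarrow> complex \<Rightarrow> complex \<Rightarrow> complex \<Rightarrow> complex \<Rightarrow> sc" where
  "cyc r s a b t = (\<lambda>i j k. case i of
     e1 \<Rightarrow> (case j of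
         e1 \<Rightarrow> (case k of e1 \<Rightarrow> 0 | e2 \<Rightarrow> 1 | f1 \<Rightarrow> 0)
       | e2 \<Rightarrow> (case k of e1 \<Rightarrow> - (r * s) | e2 \<Rightarrow> r + s | f1 \<Rightarrow> 0)
       | f1 \<Rightarrow> (case k of e1 \<Rightarrow> 0 | e2 \<Rightarrow> 0 | f1 \<Rightarrow> a))
   | e2 \<Rightarrow> (case j of
         e1 \<Rightarrow> (case k of e1 \<Rightarrow> - (r * s) | e2 \<Rightarrow> r + s | f1 \<Rightarrow> 0)
       | e2 \<Rightarrow> (case k of e1 \<Rightarrow> - (r * s) * (r + s) | e2 \<Rightarrow> (r + s)\<^sup>2 - r * s | f1 \<Rightarrow> 0)
       | f1 \<Rightarrow> (case k of e1 \<Rightarrow> 0 | e2 \<Rightarrow> 0 | f1 \<Rightarrow> a\<^sup>2))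
   | f1 \<Rightarrow> (case j of
         e1 \<Rightarrow> (case k of e1 \<Rightarrow> 0 | e2 \<Rightarrow> 0 | f1 \<Rightarrow> b)
       | e2 \<Rightarrow> (case k of e1 \<Rightarrow> 0 | e2 \<Rightarrow> 0 | f1 \<Rightarrow> b\<^sup>2)
       | f1 \<Rightarrow> (case k of e1 \<Rightarrow> (a - r - s) * t | e2 \<Rightarrow> t | f1 \<Rightarrow> 0)))"

lemma variety_even:
  assumes "c \<in> minus11_variety"
  shows "c e1 e1 f1 = 0" "c e1 e2 f1 = 0" "c e2 e1 f1 = 0" "c e2 e2 f1 = 0" "c f1 f1 f1 = 0"
    "c e1 f1 e1 = 0" "c e1 f1 e2 = 0" "c e2 f1 e1 = 0" "c e2 f1 e2 = 0"
    "c f1 e1 e1 = 0" "c f1 e1 e2 = 0" "c f1 e2 e1 = 0" "c f1 e2 e2 = 0"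
  using assms by (auto simp: minus11_variety_def even_sc_def)

lemma variety_assoc:
  assumes "c \<in> minus11_variety"
  shows "assoc_sc c i j l k = - ((-1) ^ (deg j * deg l)) * assoc_sc c i l j k"
    and "assoc_sc c i j l k + (-1) ^ (deg i * deg j + deg i * deg l) * assoc_sc c j l i k
       + (-1) ^ (deg l * deg j + deg i * deg l) * assoc_sc c l i j k = 0"
  using assms unfolding minus11_variety_iff variety_eqs_def by blast+

text \<open>Factors \<open>x^2 - q x - p\<close>, so that \<open>v^3 = p v + q v^2\<close> becomes
  \<open>v (v - r) (v - s) = 0\<close>.\<close>

lemma complex_quadratic_roots: "\<exists>r s. r + s = q \<and> - (r * s) = (p :: complex)"
proof -
  define d where "d = csqrt (q\<^sup>2 + 4 * p)"
  have "d\<^sup>2 = q\<^sup>2 + 4 * p" by (simp add: d_def)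
  then show ?thesis
    by (intro exI[of _ "(q + d) / 2"] exI[of _ "(q - d) / 2"])
      (simp add: field_simps power2_eq_square)
qed

lemma cyclic_form:
  assumes K: "K \<in> minus11_variety" "K e1 e1 e1 = 0" "K e1 e1 e2 = 1"
  obtains r s a b t where "K = cyc r s a b t" "a \<in> {0, r, s}" "b \<in> {0, r, s}"
    "t = 0 \<or> a = b \<and> a \<in> {r, s}"
proof -
  note z = variety_even[OF K(1)]
  note RA = variety_assoc(1)[OF K(1)] and CY = variety_assoc(2)[OF K(1)]
  obtain r s where rs: "r + s = K e1 e2 e2" "- (r * s) = K e1 e2 e1"
    using complex_quadratic_roots by blast
  define a b t where "a = K e1 f1 f1" and "b = K f1 e1 f1" and "t = K f1 f1 e2"
  \<comment> \<open>The associator (v, v, v) equals its own negative.\<close>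
  have c21: "K e2 e1 e1 = K e1 e2 e1" "K e2 e1 e2 = K e1 e2 e2"
    using RA[of e1 e1 e1 e1] RA[of e1 e1 e1 e2] by (simp_all add: assoc_sc_def sum_idx z K)
  have c22: "K e2 e2 e1 = K e1 e2 e2 * K e1 e2 e1" "K e2 e2 e2 = K e1 e2 e1 + (K e1 e2 e2)\<^sup>2"
    using RA[of e1 e1 e2 e1] RA[of e1 e1 e2 e2]
    by (simp_all add: assoc_sc_def sum_idx z K c21 power2_eq_square algebra_simps)
  \<comment> \<open>In (v, y, f1) = - (v, f1, y) the right side vanishes, since both actions on
    \<open>f1\<close> are by scalars. So left multiplication respects powers of \<open>v\<close>,
    and \<open>a\<close> is a root of the cubic relation of \<open>v\<close>.\<close>
  have al: "K e2 f1 f1 = a\<^sup>2" "K e1 e2 e1 * a + K e1 e2 e2 * a\<^sup>2 = a ^ 3"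
    using RA[of e1 e1 f1 f1] RA[of e1 e2 f1 f1]
    by (simp_all add: assoc_sc_def sum_idx z K a_def[symmetric] power2_eq_square power3_eq_cube algebra_simps)
  have be1: "K f1 e2 f1 = b\<^sup>2"
    using RA[of f1 e1 e1 f1]
    by (simp add: assoc_sc_def sum_idx z K b_def[symmetric] power2_eq_square algebra_simps)
  have "2 * (K e1 e2 e1 * b + K e1 e2 e2 * b\<^sup>2) = 2 * b ^ 3"
    using RA[of f1 e1 e2 f1]
    by (simp add: assoc_sc_def sum_idx z K c21 be1 b_def[symmetric] power2_eq_square power3_eq_cube algebra_simps)
  then have be: "K f1 e2 f1 = b\<^sup>2" "K e1 e2 e1 * b + K e1 e2 e2 * b\<^sup>2 = b ^ 3"
    using be1 by (simp_all only: mult_cancel_left) simp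
  \<comment> \<open>In (f1, v, f1) = - (f1, f1, v) the terms with \<open>b\<close> cancel, leaving
    \<gamma> v = a \<gamma>.\<close>
  have ga: "K f1 f1 e1 = (a - (r + s)) * t" "t * K e1 e2 e1 = a * K f1 f1 e1"
    using RA[of f1 e1 f1 e1] RA[of f1 e1 f1 e2]
    by (simp_all add: assoc_sc_def sum_idx z K c21 a_def[symmetric] b_def[symmetric] t_def[symmetric] rs algebra_simps)
  \<comment> \<open>The cyclic identity for (v, f1, f1) gives v \<gamma> = (3a - 2b) \<gamma>. The
    even part is commutative, so comparison with \<gamma> v = a \<gamma> leaves 2 (a - b) \<gamma> =
    0.\<close>
  have ab: "t * (a - b) = 0"
    using RA[of f1 e1 f1 e2] CY[of e1 f1 f1 e2]
    by (simp add: assoc_sc_def sum_idx z K c21 a_def[symmetric] b_def[symmetric] t_def[symmetric] rs algebra_simps)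
  have "a * (a - r) * (a - s) = 0" "b * (b - r) * (b - s) = 0"
    using al(2) be(2) unfolding rs[symmetric] by algebra+
  then have in3: "a \<in> {0, r, s}" "b \<in> {0, r, s}" by auto
  have "t = 0 \<or> a = b \<and> a \<in> {r, s}"
  proof (cases "t = 0")
    case False
    have "t * ((a - r) * (a - s)) = 0"
      using ga unfolding rs[symmetric] by algebra
    with False ab show ?thesis by auto
  qed simp
  moreover have "K = cyc r s a b t"
  proof (intro ext)
    fix i j k show "K i j k = cyc r s a b t i j k"
      by (cases i; cases j; cases k)
        (simp_all add: cyc_def z K c21 c22 al(1) be(1) ga(1) rs[symmetric] a_def[symmetric] b_def[symmetric]
          t_def[symmetric] algebra_simps)
  qed
  ultimately show ?thesis using that in3 by blast
qed

text \<open>Base change to v, v^2. The last conclusion expresses v^3 in the original coordinates;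
  the discriminant is later evaluated with it.\<close>

lemma cyclic_normal:
  assumes c: "c \<in> minus11_variety" and v: "v f1 = 0" and w: "w = mult c v v"
    and W: "v e1 * w e2 - v e2 * w e1 \<noteq> 0"
  obtains g h K where "gl_even g h" "K \<in> minus11_variety" "c = act g h K"
    "K e1 e1 e1 = 0" "K e1 e1 e2 = 1" "\<And>k. mult c v w k = K e1 e2 e1 * v k + K e1 e2 e2 * w k"
proof -
  define g h where "g = gmat (v e1) (v e2) (w e1) (w e2) 1" and "h = gmat_inv (v e1) (v e2) (w e1) (w e2) 1"
  have g: "gl_even g h" unfolding g_def h_def using gl_even_gmat W by simp
  define K where "K = act h g c"
  have K: "K \<in> minus11_variety" unfolding K_def using act_in_variety[OF gl_even_sym[OF g] c] .
  have wf: "w f1 = 0" using variety_even[OF c] v by (simp add: w mult_def sum_idx)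
  have gv: "app g x = (\<lambda>k. x e1 * v k + x e2 * w k)" if "x f1 = 0" for x
  proof
    show "app g x k = x e1 * v k + x e2 * w k" for k
      using that v wf by (cases k) (simp_all add: app_def sum_idx g_def gmat_def)
  qed
  have gb: "app g (basis e1) = v" "app g (basis e2) = w"
    using gv[of "basis e1"] gv[of "basis e2"] by (simp_all add: basis_def)
  have "K e1 e1 = app h w"
    using mult_act[of h g c "basis e1" "basis e1"] by (simp add: mult_basis K_def[symmetric] gb w)
  also have "\<dots> = basis e2" using app_app(2)[OF g, of "basis e2"] by (simp add: gb)
  finally have "K e1 e1 e1 = 0" "K e1 e1 e2 = 1" by (simp_all add: basis_def)
  moreover have "c = act g h K" unfolding K_def using act_inverse[OF gl_even_sym[OF g]] by simp
  moreover have "mult c v w = app g (K e1 e2)"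
    using mult_act[of h g c "basis e1" "basis e2"]
    by (simp add: mult_basis K_def[symmetric] gb app_app[OF g])
  then have "mult c v w k = K e1 e2 e1 * v k + K e1 e2 e2 * w k" for k
    using variety_even[OF K] by (simp add: gv)
  ultimately show ?thesis using that g K by blast
qed

text \<open>Common form of the five commutative representatives, with even part \<complex> +
  \<complex> in its idempotent basis, so that their invariants are computed once.\<close>

definition idem :: "complex \<Rightarrow> complex \<Rightarrow> complex \<Rightarrow> complex \<Rightarrow> complex \<Rightarrow> sc" where
  "idem a1 a2 b1 b2 t = (\<lambda>i j k. case i of
     e1 \<Rightarrow> (case j of
         e1 \<Rightarrow> (case k of e1 \<Rightarrow> 1 | e2 \<Rightarrow> 0 | f1 \<Rightarrow> 0)
       | e2 \<Rightarrow> 0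
       | f1 \<Rightarrow> (case k of e1 \<Rightarrow> 0 | e2 \<Rightarrow> 0 | f1 \<Rightarrow> a1))
   | e2 \<Rightarrow> (case j of
         e1 \<Rightarrow> 0
       | e2 \<Rightarrow> (case k of e1 \<Rightarrow> 0 | e2 \<Rightarrow> 1 | f1 \<Rightarrow> 0)
       | f1 \<Rightarrow> (case k of e1 \<Rightarrow> 0 | e2 \<Rightarrow> 0 | f1 \<Rightarrow> a2))
   | f1 \<Rightarrow> (case j of
         e1 \<Rightarrow> (case k of e1 \<Rightarrow> 0 | e2 \<Rightarrow> 0 | f1 \<Rightarrow> b1)
       | e2 \<Rightarrow> (case k of e1 \<Rightarrow> 0 | e2 \<Rightarrow> 0 | f1 \<Rightarrow> b2)
       | f1 \<Rightarrow> (case k of e1 \<Rightarrow> t | e2 \<Rightarrow> 0 | f1 \<Rightarrow> 0)))"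

lemma R_idem:
  "R01 = idem 0 0 0 0 0" "R03 = idem 1 0 1 0 1" "R04 = idem 0 0 1 0 0"
  "R05 = idem 1 0 0 0 0" "R07 = idem 0 1 1 0 0"
  by (intro ext; case_tac x; case_tac xa; case_tac xb;
      simp add: idem_def mk_def R01_def R03_def R04_def R05_def R07_def)+

text \<open>Lagrange interpolation at the nonzero roots gives the orthogonal idempotents
  \<open>x v (v - s)\<close> and \<open>y v (v - r)\<close>; these are the even columns of
  \<open>g\<close>. Their actions on \<open>f1\<close> are the same polynomials evaluated at
  \<open>a\<close> and \<open>b\<close>, and \<open>u\<close> rescales \<open>f1\<close>.\<close>

lemma cyc_in_orbit_idem:
  assumes "r \<noteq> 0" "s \<noteq> 0" "r \<noteq> s" "u \<noteq> 0"
    and xy: "x * (r * (r - s)) = 1" "y * (s * (s - r)) = 1"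
    and al: "a * (a - s) * x = a1" "a * (a - r) * y = a2"
    and be: "b * (b - s) * x = b1" "b * (b - r) * y = b2"
    and ga: "u * u * t = t1 * x" "u * u * ((a - r - s) * t) = - (t1 * s * x)"
  shows "cyc r s a b t \<in> orbit (idem a1 a2 b1 b2 t1)"
proof -
  define g h where "g = gmat (- s * x) x (- r * y) y u" and
    "h = gmat_inv (- s * x) x (- r * y) y u"
  have "(- s * x) * y - x * (- r * y) = x * y * (r - s)" by algebra
  also have "\<dots> \<noteq> 0" using assms by auto
  finally have g: "gl_even g h"
    unfolding g_def h_def using gl_even_gmat \<open>u \<noteq> 0\<close> by blast
  have eqs: "2 * (s * (x * (x * (r * s)))) - x * x * (r * s * (r + s)) = - (s * x)"
    "s * x * (s * x) + x * x * ((r + s)\<^sup>2 - r * s) - 2 * (s * (x * (x * (r + s)))) = x"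
    using xy by algebra+
  have eqs2: "2 * (r * (y * (y * (r * s)))) - y * y * (r * s * (r + s)) = - (r * y)"
    "r * y * (r * y) + y * y * ((r + s)\<^sup>2 - r * s) - 2 * (r * (y * (y * (r + s)))) = y"
    using xy by algebra+
  have eqs3: "s * x * y * (r * s) + (x * (r * y) * (r * s) - x * y * (r * s * (r + s))) = 0"
    "s * x * (r * y) - s * x * y * (r + s) + (x * y * ((r + s)\<^sup>2 - r * s) - x * (r * y) * (r + s)) = 0"
    "r * y * x * (r * s) + (y * (s * x) * (r * s) - y * x * (r * s * (r + s))) = 0"
    "r * y * (s * x) - r * y * x * (r + s) + (y * x * ((r + s)\<^sup>2 - r * s) - y * (s * x) * (r + s)) = 0"
    by algebra+
  have eqs4: "x * u * a\<^sup>2 - s * x * u * a = u * a1" "y * u * a\<^sup>2 - r * y * u * a = u * a2"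
    unfolding al[symmetric] by (simp_all add: algebra_simps power2_eq_square)
  have eqs5: "u * x * b\<^sup>2 - u * (s * x) * b = u * b1" "u * y * b\<^sup>2 - u * (r * y) * b = u * b2"
    "u * u * ((a - r - s) * t) = - (s * x * t1)" "u * u * t = x * t1"
    using ga unfolding be[symmetric] by (simp_all add: algebra_simps power2_eq_square)
  show ?thesis
  proof (rule orbitI[OF g], rule ext)
    fix i j k
    show "mult (cyc r s a b t) (\<lambda>a. g a i) (\<lambda>a. g a j) k = app g (idem a1 a2 b1 b2 t1 i j) k"
      by (cases i; cases j; cases k;
          simp add: mult_def app_def sum_idx cyc_def g_def gmat_def idem_def; (simp add: eqs eqs2 eqs3 eqs4 eqs5)?)
  qed
qed

lemma cyc_in_orbit:
  assumes rs: "r \<noteq> 0" "s \<noteq> 0" "r \<noteq> s"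
  shows "cyc r s 0 0 0 \<in> orbit R01" "t \<noteq> 0 \<Longrightarrow> cyc r s r r t \<in> orbit R03"
    "cyc r s 0 r 0 \<in> orbit R04" "cyc r s r 0 0 \<in> orbit R05" "cyc r s s r 0 \<in> orbit R07"
proof -
  define x y where "x = 1 / (r * (r - s))" and "y = 1 / (s * (s - r))"
  have xy: "x * (r * (r - s)) = 1" "y * (s * (s - r)) = 1" using rs by (simp_all add: x_def y_def)
  then have xy': "r * (r - s) * x = 1" "s * (s - r) * y = 1" by (simp_all add: mult_ac)
  show "cyc r s 0 0 0 \<in> orbit R01" "cyc r s 0 r 0 \<in> orbit R04" "cyc r s r 0 0 \<in> orbit R05"
    "cyc r s s r 0 \<in> orbit R07"
    unfolding R_idem using xy'
    by (auto intro!: cyc_in_orbit_idem[OF rs _ xy, of 1])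
  assume t: "t \<noteq> 0"
  \<comment> \<open>For \<open>a = r\<close> the square of \<open>f1\<close> is
    \<open>t v (v - s)\<close>; this scaling turns it into the first idempotent.\<close>
  define u where "u = csqrt (x / t)"
  have u: "u * u * t = x" using t by (simp add: u_def power2_eq_square[symmetric])
  moreover have "u \<noteq> 0" using u xy by auto
  moreover have "u * u * ((r - r - s) * t) = - (1 * s * x)"
    unfolding u[symmetric] by (simp add: algebra_simps)
  ultimately show "cyc r s r r t \<in> orbit R03"
    unfolding R_idem using xy' by (intro cyc_in_orbit_idem[OF rs _ xy, of u]) auto
qed

lemma cyc_tendsto:
  assumes "R \<longlonglongrightarrow> r" "S \<longlonglongrightarrow> s" "A \<longlonglongrightarrow> a" "B \<longlonglongrightarrow> b" "T \<longlonglongrightarrow> t"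
  shows "(\<lambda>n. cyc (R n) (S n) (A n) (B n) (T n) i j k) \<longlonglongrightarrow> cyc r s a b t i j k"
  by (cases i; cases j; cases k; simp add: cyc_def; intro tendsto_intros assms)

text \<open>The perturbations of \<open>r\<close> and \<open>s\<close> have different slopes, so
  that \<open>R n = S n\<close> excludes a single value of \<open>d n\<close> even when
  \<open>r = s\<close>. An injective null sequence takes the finitely many bad values only finitely
  often.\<close>

lemma generic_sequences:
  obtains R S T :: "nat \<Rightarrow> complex" where "R \<longlonglongrightarrow> r" "S \<longlonglongrightarrow> s" "T \<longlonglongrightarrow> t"
    "\<And>n. R n \<noteq> 0" "\<And>n. S n \<noteq> 0" "\<And>n. R n \<noteq> S n" "\<And>n. T n \<noteq> 0"
proof -
  define e :: "nat \<Rightarrow> complex" where "e n = of_real (inverse (real (Suc n)))" for n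
  have e0: "e \<longlonglongrightarrow> 0" unfolding e_def
    using tendsto_of_real[OF LIMSEQ_inverse_real_of_nat, where 'a = complex] by simp
  have "inj e" by (auto simp: inj_on_def e_def)
  then have "finite (e -` {-r, -s / 2, r - s, -t})" by (intro finite_vimageI) auto
  then obtain N where N: "\<forall>n\<in>e -` {-r, -s / 2, r - s, -t}. n < N"
    unfolding finite_nat_set_iff_bounded by (rule exE)
  define d where "d n = e (n + N)" for n
  have d0: "d \<longlonglongrightarrow> 0" unfolding d_def using LIMSEQ_ignore_initial_segment[OF e0] .
  have d: "d n \<notin> {-r, -s / 2, r - s, -t}" for n
    using N[rule_format, of "n + N"] unfolding d_def by auto
  show ?thesis
  proof (rule that[of "\<lambda>n. r + d n" "\<lambda>n. s + 2 * d n" "\<lambda>n. t + d n"])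
    show "(\<lambda>n. r + d n) \<longlonglongrightarrow> r" "(\<lambda>n. s + 2 * d n) \<longlonglongrightarrow> s" "(\<lambda>n. t + d n) \<longlonglongrightarrow> t"
      by (auto intro!: tendsto_eq_intros d0)
    fix n
    show "r + d n \<noteq> 0" "s + 2 * d n \<noteq> 0" "r + d n \<noteq> s + 2 * d n" "t + d n \<noteq> 0"
      using d[of n] by (auto simp: add_eq_0_iff field_simps)
  qed
qed

lemma cyc_in_zclosure:
  "cyc r s 0 0 0 \<in> zclosure (orbit R01)" "cyc r s r r t \<in> zclosure (orbit R03)"
  "cyc r s 0 r 0 \<in> zclosure (orbit R04)" "cyc r s r 0 0 \<in> zclosure (orbit R05)"
  "cyc r s s r 0 \<in> zclosure (orbit R07)"
proof -
  obtain R S T :: "nat \<Rightarrow> complex" where L: "R \<longlonglongrightarrow> r" "S \<longlonglongrightarrow> s" "T \<longlonglongrightarrow> t"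
    and N: "\<And>n. R n \<noteq> 0" "\<And>n. S n \<noteq> 0" "\<And>n. R n \<noteq> S n" "\<And>n. T n \<noteq> 0"
    by (rule generic_sequences[of r s t]) (rule that; assumption)
  note Z = tendsto_const[of 0]
  note O = cyc_in_orbit[OF N(1-3), THEN subsetD[OF zclosure_subset]]
  show "cyc r s 0 0 0 \<in> zclosure (orbit R01)"
    by (rule zclosure_limit[OF O(1) cyc_tendsto[OF L(1,2) Z Z Z]])
  show "cyc r s r r t \<in> zclosure (orbit R03)"
    by (rule zclosure_limit[OF O(2)[OF N(4)] cyc_tendsto[OF L(1,2) L(1) L(1) L(3)]])
  show "cyc r s 0 r 0 \<in> zclosure (orbit R04)"
    by (rule zclosure_limit[OF O(3) cyc_tendsto[OF L(1,2) Z L(1) Z]])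
  show "cyc r s r 0 0 \<in> zclosure (orbit R05)"
    by (rule zclosure_limit[OF O(4) cyc_tendsto[OF L(1,2) L(1) Z Z]])
  show "cyc r s s r 0 \<in> zclosure (orbit R07)"
    by (rule zclosure_limit[OF O(5) cyc_tendsto[OF L(1,2) L(2) L(1) Z]])
qed

lemma cyc_swap: "cyc r s a b t = cyc s r a b t"
  by (intro ext; case_tac x; case_tac xa; case_tac xb; simp add: cyc_def algebra_simps)

text \<open>Up to exchanging \<open>r\<close> and \<open>s\<close>, the nine pairs
  \<open>(a, b)\<close> form five types, one for each commutative representative.\<close>

lemma cyc_cases:
  assumes "a \<in> {0, r, s}" "b \<in> {0, r, s}" "t = 0 \<or> a = b \<and> a \<in> {r, s}"
  shows "cyc r s a b t \<in> {cyc r s 0 0 0, cyc r s 0 r 0, cyc s r 0 s 0, cyc r s r 0 0, cyc s r s 0 0,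
    cyc r s s r 0, cyc s r r s 0, cyc r s r r t, cyc s r s s t}"
  using assms cyc_swap[of r s] by auto

section \<open>Noncyclic algebras\<close>

text \<open>Here \<phi> has the values \<open>p\<close>, \<open>q\<close> on \<open>e1\<close>,
  \<open>e2\<close>, and \<alpha> = m \<phi>, \<beta> = n \<phi>. In \<open>right_sc\<close> too,
  \<open>m\<close> belongs to the left and \<open>n\<close> to the right action on
  \<open>f1\<close>.\<close>

definition left_sc :: "complex \<Rightarrow> complex \<Rightarrow> complex \<Rightarrow> complex \<Rightarrow> sc" where
  "left_sc p q m n = (\<lambda>i j k. case i of
     e1 \<Rightarrow> (if j = k then (if j = f1 then m * p else p) else 0)
   | e2 \<Rightarrow> (if j = k then (if j = f1 then m * q else q) else 0)
   | f1 \<Rightarrow> (if k = f1 then (case j of e1 \<Rightarrow> n * p | e2 \<Rightarrow> n * q | f1 \<Rightarrow> 0) else 0))"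

definition right_sc :: "complex \<Rightarrow> complex \<Rightarrow> complex \<Rightarrow> complex \<Rightarrow> sc" where
  "right_sc p q m n = (\<lambda>i j k. case j of
     e1 \<Rightarrow> (if i = k then (if i = f1 then n * p else p) else 0)
   | e2 \<Rightarrow> (if i = k then (if i = f1 then n * q else q) else 0)
   | f1 \<Rightarrow> (if k = f1 then (case i of e1 \<Rightarrow> m * p | e2 \<Rightarrow> m * q | f1 \<Rightarrow> 0) else 0))"

definition null_sc :: "complex \<Rightarrow> complex \<Rightarrow> sc" where
  "null_sc x y = (\<lambda>i j k. if i = f1 \<and> j = f1 then (case k of e1 \<Rightarrow> x | e2 \<Rightarrow> y | f1 \<Rightarrow> 0) else 0)"

lemma R_left:
  "R23 = left_sc 1 0 0 0" "R29 = left_sc 1 0 0 1" "R32 = left_sc 1 0 1 0" "R36 = left_sc 1 0 1 1"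
  by (intro ext; case_tac x; case_tac xa; case_tac xb;
      simp add: left_sc_def mk_def R23_def R29_def R32_def R36_def)+

lemma R_right:
  "R25 = right_sc 1 0 0 0" "R31 = right_sc 1 0 0 1" "R26 = right_sc 1 0 1 0" "R33 = right_sc 1 0 1 1"
  by (intro ext; case_tac x; case_tac xa; case_tac xb;
      simp add: right_sc_def mk_def R25_def R26_def R31_def R33_def)+

text \<open>The new even basis consists of a vector with \<phi> = 1 and one spanning the kernel of
  \<phi>.\<close>

lemma left_in_orbit:
  assumes "p \<noteq> 0 \<or> q \<noteq> 0"
  shows "left_sc p q m n \<in> orbit (left_sc 1 0 m n)"
proof (cases "p = 0")
  case False
  have g: "gl_even (gmat (1 / p) 0 (- q) p 1) (gmat_inv (1 / p) 0 (- q) p 1)"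
    using False by (intro gl_even_gmat) simp_all
  show ?thesis
  proof (rule orbitI[OF g], rule ext)
    fix i j k
    show "mult (left_sc p q m n) (\<lambda>a. gmat (1 / p) 0 (- q) p 1 a i) (\<lambda>a. gmat (1 / p) 0 (- q) p 1 a j) k
        = app (gmat (1 / p) 0 (- q) p 1) (left_sc 1 0 m n i j) k"
      using False by (cases i; cases j; cases k)
        (simp_all add: mult_def app_def sum_idx left_sc_def gmat_def)
  qed
next
  case True
  with assms have q: "q \<noteq> 0" by simp
  have g: "gl_even (gmat 0 (1 / q) 1 0 1) (gmat_inv 0 (1 / q) 1 0 1)"
    using q by (intro gl_even_gmat) simp_all
  show ?thesis
  proof (rule orbitI[OF g], rule ext)
    fix i j k
    show "mult (left_sc p q m n) (\<lambda>a. gmat 0 (1 / q) 1 0 1 a i) (\<lambda>a. gmat 0 (1 / q) 1 0 1 a j) k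
        = app (gmat 0 (1 / q) 1 0 1) (left_sc 1 0 m n i j) k"
      using True q by (cases i; cases j; cases k)
        (simp_all add: mult_def app_def sum_idx left_sc_def gmat_def)
  qed
qed

lemma right_in_orbit:
  assumes "p \<noteq> 0 \<or> q \<noteq> 0"
  shows "right_sc p q m n \<in> orbit (right_sc 1 0 m n)"
proof (cases "p = 0")
  case False
  have g: "gl_even (gmat (1 / p) 0 (- q) p 1) (gmat_inv (1 / p) 0 (- q) p 1)"
    using False by (intro gl_even_gmat) simp_all
  show ?thesis
  proof (rule orbitI[OF g], rule ext)
    fix i j k
    show "mult (right_sc p q m n) (\<lambda>a. gmat (1 / p) 0 (- q) p 1 a i) (\<lambda>a. gmat (1 / p) 0 (- q) p 1 a j) k
        = app (gmat (1 / p) 0 (- q) p 1) (right_sc 1 0 m n i j) k"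
      using False by (cases i; cases j; cases k)
        (simp_all add: mult_def app_def sum_idx right_sc_def gmat_def)
  qed
next
  case True
  with assms have q: "q \<noteq> 0" by simp
  have g: "gl_even (gmat 0 (1 / q) 1 0 1) (gmat_inv 0 (1 / q) 1 0 1)"
    using q by (intro gl_even_gmat) simp_all
  show ?thesis
  proof (rule orbitI[OF g], rule ext)
    fix i j k
    show "mult (right_sc p q m n) (\<lambda>a. gmat 0 (1 / q) 1 0 1 a i) (\<lambda>a. gmat 0 (1 / q) 1 0 1 a j) k
        = app (gmat 0 (1 / q) 1 0 1) (right_sc 1 0 m n i j) k"
      using True q by (cases i; cases j; cases k)
        (simp_all add: mult_def app_def sum_idx right_sc_def gmat_def)
  qed
qed

lemma null_tendsto:
  "R \<longlonglongrightarrow> x \<Longrightarrow> S \<longlonglongrightarrow> y \<Longrightarrow> (\<lambda>n. null_sc (R n) (S n) i j k) \<longlonglongrightarrow> null_sc x y i j k"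
  by (cases i; cases j; cases k; simp add: null_sc_def)

text \<open>Rescaling the even part of \<open>R03\<close> by a small factor kills every product except the square
  of \<open>f1\<close>.\<close>

lemma null_in_zclosure: "null_sc x y \<in> zclosure (orbit R03)"
proof -
  define M :: "complex \<Rightarrow> sc" where "M e = (\<lambda>i j k.
      if (i, j, k) \<in> {(e1,e1,e1), (e2,e2,e2), (e1,f1,f1), (f1,e1,f1)} then e
      else if (i, j, k) = (f1,f1,e1) then 1 else 0)" for e
  have M: "M e \<in> orbit R03" if "e \<noteq> 0" for e
  proof -
    \<comment> \<open>The idempotents of \<open>R03\<close> are \<open>e1 / e\<close> and
      \<open>e2 / e\<close> here; \<open>f1\<close> needs a square root as factor for its square to
      be the first of them.\<close>
    define u where "u = csqrt (1 / e)"
    have u: "u * u = 1 / e" by (simp add: u_def power2_eq_square[symmetric])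
    then have "u \<noteq> 0" using that by auto
    then have g: "gl_even (gmat (1 / e) 0 0 (1 / e) u) (gmat_inv (1 / e) 0 0 (1 / e) u)"
      using that by (intro gl_even_gmat) simp_all
    show ?thesis
    proof (rule orbitI[OF g], rule ext)
      fix i j k
      show "mult (M e) (\<lambda>a. gmat (1 / e) 0 0 (1 / e) u a i) (\<lambda>a. gmat (1 / e) 0 0 (1 / e) u a j) k
          = app (gmat (1 / e) 0 0 (1 / e) u) (R03 i j) k"
        using that u by (cases i; cases j; cases k)
          (simp_all add: mult_def app_def sum_idx M_def gmat_def R03_def mk_def)
    qed
  qed
  have lim: "(\<lambda>n. inverse (of_nat (Suc n)) :: complex) \<longlonglongrightarrow> 0"
    using tendsto_of_real[OF LIMSEQ_inverse_real_of_nat, where 'a = complex] by simp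
  have base: "null_sc 1 0 \<in> zclosure (orbit R03)"
  proof (rule zclosure_limit)
    show "M (inverse (of_nat (Suc n))) \<in> zclosure (orbit R03)" for n
      by (rule subsetD[OF zclosure_subset], rule M) (simp del: of_nat_Suc)
    fix i j k
    show "(\<lambda>n. M (inverse (of_nat (Suc n))) i j k) \<longlonglongrightarrow> null_sc 1 0 i j k"
      using lim by (cases i; cases j; cases k) (simp_all add: M_def null_sc_def)
  qed
  \<comment> \<open>Any nonzero (x, y) is the first column of an invertible matrix, which carries
    \<open>null_sc 1 0\<close> to \<open>null_sc x y\<close>. The zero product is treated afterwards
    as a limit.\<close>
  have move: "null_sc x y \<in> zclosure (orbit R03)" if "x \<noteq> 0 \<or> y \<noteq> 0" for x y
  proof -
    obtain c d where D: "x * d - y * c \<noteq> 0"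
    proof (cases "x = 0")
      case True
      then show ?thesis using \<open>x \<noteq> 0 \<or> y \<noteq> 0\<close> that[of 0 1] by simp
    next
      case False
      then show ?thesis using that[of 1 0] by simp
    qed
    have "null_sc x y = act (gmat x y c d 1) (gmat_inv x y c d 1) (null_sc 1 0)"
    proof (intro ext)
      fix i j k
      show "null_sc x y i j k = act (gmat x y c d 1) (gmat_inv x y c d 1) (null_sc 1 0) i j k"
        by (cases i; cases j; cases k) (simp_all add: act_def sum_idx gmat_def gmat_inv_def null_sc_def)
    qed
    then show ?thesis using act_in_zclosure_orbit[OF gl_even_gmat[OF D] base] by simp
  qed
  show ?thesis
  proof (cases "x \<noteq> 0 \<or> y \<noteq> 0")
    case False
    have "null_sc (inverse (of_nat (Suc n))) 0 \<in> zclosure (orbit R03)" for n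
      by (rule move) (simp del: of_nat_Suc)
    from zclosure_limit[OF this null_tendsto[OF lim tendsto_const]] show ?thesis using False by simp
  qed (rule move)
qed

text \<open>Associators with odd arguments, read for even x, y. From (x, y, f1) and the cyclic
  identity, \<alpha> and \<beta> are multiplicative. From (f1, x, f1) = - (f1, f1, x), \<gamma> x =
  \<alpha>(x) \<gamma>. Substituting this into the cyclic identity for (x, f1, f1) gives x \<gamma>
  = (3 \<alpha>(x) - 2 \<beta>(x)) \<gamma>.\<close>

lemma variety_odd:
  assumes c: "c \<in> minus11_variety" and ij: "deg i = 0" "deg j = 0"
  shows "c i j e1 * c e1 f1 f1 + c i j e2 * c e2 f1 f1 = c i f1 f1 * c j f1 f1"
    and "c i j e1 * c f1 e1 f1 + c i j e2 * c f1 e2 f1 = c f1 i f1 * c f1 j f1"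
    and "c f1 f1 e1 * c e1 i j + c f1 f1 e2 * c e2 i j = c i f1 f1 * c f1 f1 j"
    and "c i e1 j * c f1 f1 e1 + c i e2 j * c f1 f1 e2 = (3 * c i f1 f1 - 2 * c f1 i f1) * c f1 f1 j"
proof -
  note z = variety_even[OF c]
  have i: "i = e1 \<or> i = e2" and j: "j = e1 \<or> j = e2" using ij by (cases i; cases j; simp)+
  show al: "c i j e1 * c e1 f1 f1 + c i j e2 * c e2 f1 f1 = c i f1 f1 * c j f1 f1"
    using variety_assoc(1)[OF c, of i j f1 f1] i j by (auto simp: assoc_sc_def sum_idx z algebra_simps)
  have "(c i j e1 * c e1 f1 f1 + c i j e2 * c e2 f1 f1 - c i f1 f1 * c j f1 f1)
      + (c f1 i f1 * c f1 j f1 - (c i j e1 * c f1 e1 f1 + c i j e2 * c f1 e2 f1)) = 0"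
    using variety_assoc(2)[OF c, of i j f1 f1] i j by (auto simp: assoc_sc_def sum_idx z algebra_simps)
  then show "c i j e1 * c f1 e1 f1 + c i j e2 * c f1 e2 f1 = c f1 i f1 * c f1 j f1"
    using al by simp
  show ga: "c f1 f1 e1 * c e1 i j + c f1 f1 e2 * c e2 i j = c i f1 f1 * c f1 f1 j"
    using variety_assoc(1)[OF c, of f1 i f1 j] i j by (auto simp: assoc_sc_def sum_idx z algebra_simps)
  have "(c i f1 f1 * c f1 f1 j - (c i e1 j * c f1 f1 e1 + c i e2 j * c f1 f1 e2))
      + ((c f1 f1 e1 * c e1 i j + c f1 f1 e2 * c e2 i j) - c f1 i f1 * c f1 f1 j)
      - (c f1 i f1 - c i f1 f1) * c f1 f1 j = 0"
    using variety_assoc(2)[OF c, of i f1 f1 j] i j by (auto simp: assoc_sc_def sum_idx z algebra_simps)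
  then show "c i e1 j * c f1 f1 e1 + c i e2 j * c f1 f1 e2 = (3 * c i f1 f1 - 2 * c f1 i f1) * c f1 f1 j"
    using ga by algebra
qed

text \<open>The equations \<open>nc\<close> say that the even product is x y = \<lambda>(x) y +
  \<rho>(y) x with linear \<lambda> = (r, q) and \<rho> = (s, p) in the notation of the proof. Right
  alternativity makes all products of a value of \<lambda> with a value of \<rho> vanish, so one of
  the two functionals is zero.\<close>

lemma noncyclic_form:
  assumes c: "c \<in> minus11_variety"
    and nc: "c e1 e1 e2 = 0" "c e2 e2 e1 = 0" "c e1 e1 e1 = c e1 e2 e2 + c e2 e1 e2"
      "c e2 e2 e2 = c e1 e2 e1 + c e2 e1 e1"
  obtains (left) p q m n where "c = left_sc p q m n" "p \<noteq> 0 \<or> q \<noteq> 0" "m \<in> {0, 1}" "n \<in> {0, 1}"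
    | (right) p q m n where "c = right_sc p q m n" "p \<noteq> 0 \<or> q \<noteq> 0" "m \<in> {0, 1}" "n \<in> {0, 1}"
    | (null) x y where "c = null_sc x y"
proof -
  note z = variety_even[OF c]
  note RA = variety_assoc(1)[OF c]
  define p q r s where "p = c e1 e2 e1" and "q = c e2 e1 e1" and "r = c e1 e2 e2" and "s = c e2 e1 e2"
  note d = p_def[symmetric] q_def[symmetric] r_def[symmetric] s_def[symmetric]
  define a1 a2 b1 b2 g1 g2 where "a1 = c e1 f1 f1" and "a2 = c e2 f1 f1" and "b1 = c f1 e1 f1"
    and "b2 = c f1 e2 f1" and "g1 = c f1 f1 e1" and "g2 = c f1 f1 e2"
  note od = a1_def[symmetric] a2_def[symmetric] b1_def[symmetric] b2_def[symmetric] g1_def[symmetric]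
    g2_def[symmetric]
  have "r * s = 0" "q * s = 0" "p * q = 0" "p * r = 0"
    using RA[of e2 e1 e1 e1] RA[of e2 e1 e1 e2] RA[of e1 e2 e2 e1] RA[of e1 e2 e2 e2]
    by (simp_all add: assoc_sc_def sum_idx z nc d algebra_simps)
  then consider "p = 0" "s = 0" "q \<noteq> 0 \<or> r \<noteq> 0" | "q = 0" "r = 0" "p \<noteq> 0 \<or> s \<noteq> 0"
    | "p = 0" "q = 0" "r = 0" "s = 0" by auto
  then show ?thesis
  proof cases
    case 1
    have al: "(r - a1) * a1 = 0" "(r - a1) * a2 = 0" "(q - a2) * a1 = 0" "(q - a2) * a2 = 0"
      using variety_odd(1)[OF c, of e1 e1] variety_odd(1)[OF c, of e1 e2]
        variety_odd(1)[OF c, of e2 e1] variety_odd(1)[OF c, of e2 e2]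
      by (simp_all only: deg.simps nc d od 1(1,2)) (simp_all add: algebra_simps)
    have be: "(r - b1) * b1 = 0" "(r - b1) * b2 = 0" "(q - b2) * b1 = 0" "(q - b2) * b2 = 0"
      using variety_odd(2)[OF c, of e1 e1] variety_odd(2)[OF c, of e1 e2]
        variety_odd(2)[OF c, of e2 e1] variety_odd(2)[OF c, of e2 e2]
      by (simp_all only: deg.simps nc d od 1(1,2)) (simp_all add: algebra_simps)
    \<comment> \<open>Multiplicativity on x y = \<phi>(x) y reads \<alpha>(x) \<alpha>(y) =
      \<phi>(x) \<alpha>(y), so \<alpha> is 0 or \<phi>; likewise \<beta>.\<close>
    define m :: complex where "m = (if a1 = 0 \<and> a2 = 0 then 0 else 1)"
    have m: "m \<in> {0, 1}" "a1 = m * r" "a2 = m * q"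
      using al by (auto simp: m_def)
    define n :: complex where "n = (if b1 = 0 \<and> b2 = 0 then 0 else 1)"
    have n: "n \<in> {0, 1}" "b1 = n * r" "b2 = n * q"
      using be by (auto simp: n_def)
    have ga: "g1 * r + g2 * q = a1 * g1" "0 = a1 * g2" "0 = a2 * g1" "g1 * r + g2 * q = a2 * g2"
      using variety_odd(3)[OF c, of e1 e1] variety_odd(3)[OF c, of e1 e2]
        variety_odd(3)[OF c, of e2 e1] variety_odd(3)[OF c, of e2 e2]
      by (simp_all add: nc d od 1(1,2))
    have ga': "r * g1 = (3 * a1 - 2 * b1) * g1" "r * g2 = (3 * a1 - 2 * b1) * g2"
      "q * g1 = (3 * a2 - 2 * b2) * g1" "q * g2 = (3 * a2 - 2 * b2) * g2"
      using variety_odd(4)[OF c, of e1 e1] variety_odd(4)[OF c, of e1 e2]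
        variety_odd(4)[OF c, of e2 e1] variety_odd(4)[OF c, of e2 e2]
      by (simp_all add: nc d od 1(1,2))
    have "g1 = 0 \<and> g2 = 0"
    proof (rule ccontr)
      assume g: "\<not> (g1 = 0 \<and> g2 = 0)"
      \<comment> \<open>\<phi>(\<gamma>) x = \<alpha>(x) \<gamma> for all x compares a scalar map
        with one of rank at most 1, so both vanish. The other eigenvalue equation becomes \<phi> = -
        2 n \<phi>, impossible for \<open>n\<close> in \<open>{0, 1}\<close>.\<close>
      then have "a1 = 0" "a2 = 0" using ga by (cases "g1 = 0"; simp)+
      then have "(r + 2 * b1) * g1 = 0" "(r + 2 * b1) * g2 = 0" "(q + 2 * b2) * g1 = 0" "(q + 2 * b2) * g2 = 0"
        using ga' by (simp_all add: distrib_right)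
      then have "r * (1 + 2 * n) * g1 = 0" "r * (1 + 2 * n) * g2 = 0" "q * (1 + 2 * n) * g1 = 0"
        "q * (1 + 2 * n) * g2 = 0" unfolding n(2,3) by (simp_all add: algebra_simps)
      then have "r * (1 + 2 * n) = 0" "q * (1 + 2 * n) = 0"
        using g by (simp_all only: mult_eq_0_iff) blast+
      moreover have "1 + 2 * n \<noteq> 0" using n(1) by auto
      ultimately show False using 1(3) by simp
    qed
    then have "c = left_sc r q m n"
      using m n by (intro ext, case_tac x; case_tac xa; case_tac xb)
        (simp_all add: left_sc_def z nc d od 1(1,2))
    then show ?thesis using left 1(3) m n by blast
  next
    case 2
    have al: "(s - a1) * a1 = 0" "(p - a2) * a1 = 0" "(s - a1) * a2 = 0" "(p - a2) * a2 = 0"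
      using variety_odd(1)[OF c, of e1 e1] variety_odd(1)[OF c, of e1 e2]
        variety_odd(1)[OF c, of e2 e1] variety_odd(1)[OF c, of e2 e2]
      by (simp_all only: deg.simps nc d od 2(1,2)) (simp_all add: algebra_simps)
    have be: "(s - b1) * b1 = 0" "(p - b2) * b1 = 0" "(s - b1) * b2 = 0" "(p - b2) * b2 = 0"
      using variety_odd(2)[OF c, of e1 e1] variety_odd(2)[OF c, of e1 e2]
        variety_odd(2)[OF c, of e2 e1] variety_odd(2)[OF c, of e2 e2]
      by (simp_all only: deg.simps nc d od 2(1,2)) (simp_all add: algebra_simps)
    define m :: complex where "m = (if a1 = 0 \<and> a2 = 0 then 0 else 1)"
    have m: "m \<in> {0, 1}" "a1 = m * s" "a2 = m * p"
      using al by (auto simp: m_def)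
    define n :: complex where "n = (if b1 = 0 \<and> b2 = 0 then 0 else 1)"
    have n: "n \<in> {0, 1}" "b1 = n * s" "b2 = n * p"
      using be by (auto simp: n_def)
    have ga: "g1 * s = a1 * g1" "g2 * s = a1 * g2" "g1 * p = a2 * g1" "g2 * p = a2 * g2"
      using variety_odd(3)[OF c, of e1 e1] variety_odd(3)[OF c, of e1 e2]
        variety_odd(3)[OF c, of e2 e1] variety_odd(3)[OF c, of e2 e2]
      by (simp_all add: nc d od 2(1,2))
    have ga': "s * g1 + p * g2 = (3 * a1 - 2 * b1) * g1" "0 = (3 * a1 - 2 * b1) * g2"
      "0 = (3 * a2 - 2 * b2) * g1" "s * g1 + p * g2 = (3 * a2 - 2 * b2) * g2"
      using variety_odd(4)[OF c, of e1 e1] variety_odd(4)[OF c, of e1 e2]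
        variety_odd(4)[OF c, of e2 e1] variety_odd(4)[OF c, of e2 e2]
      by (simp_all add: nc d od 2(1,2))
    have "g1 = 0 \<and> g2 = 0"
    proof (rule ccontr)
      assume g: "\<not> (g1 = 0 \<and> g2 = 0)"
      \<comment> \<open>Now \<gamma> x = \<phi>(x) \<gamma> gives \<alpha> = \<phi>, and the rank
        argument applies to left multiplication, leaving 3 \<phi> = 2 n \<phi>.\<close>
      then have a: "a1 = s" "a2 = p" using ga by (cases "g1 = 0"; simp)+
      then have "s * g1 + p * g2 = 0" using ga' g by (cases "g1 = 0"; simp)
      then have "(3 * a1 - 2 * b1) * g1 = 0" "(3 * a1 - 2 * b1) * g2 = 0" "(3 * a2 - 2 * b2) * g1 = 0"
        "(3 * a2 - 2 * b2) * g2 = 0" using ga' by (simp_all only:)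
      then have "s * (3 - 2 * n) * g1 = 0" "s * (3 - 2 * n) * g2 = 0" "p * (3 - 2 * n) * g1 = 0"
        "p * (3 - 2 * n) * g2 = 0" unfolding n(2,3) a by (simp_all add: algebra_simps)
      then have "s * (3 - 2 * n) = 0" "p * (3 - 2 * n) = 0"
        using g by (simp_all only: mult_eq_0_iff) blast+
      moreover have "3 - 2 * n \<noteq> 0" using n(1) by auto
      ultimately show False using 2(3) by simp
    qed
    then have "c = right_sc s p m n"
      using m n by (intro ext, case_tac x; case_tac xa; case_tac xb)
        (simp_all add: right_sc_def z nc d od 2(1,2))
    then show ?thesis using right 2(3) m n by blast
  next
    case 3
    have "a1 = 0" "a2 = 0" "b1 = 0" "b2 = 0"
      using variety_odd(1)[OF c, of e1 e1] variety_odd(1)[OF c, of e2 e2]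
        variety_odd(2)[OF c, of e1 e1] variety_odd(2)[OF c, of e2 e2]
      by (simp_all add: nc d od 3)
    then have "c = null_sc g1 g2"
      by (intro ext, case_tac x; case_tac xa; case_tac xb)
        (simp_all add: null_sc_def z nc d od 3)
    then show ?thesis by (rule null)
  qed
qed

section \<open>The thirteen orbit closures cover the variety\<close>

definition R_comm :: "sc set" where
  "R_comm = {R01, R03, R04, R05, R07}"

definition R_noncomm :: "sc set" where
  "R_noncomm = {R23, R25, R26, R29, R31, R32, R33, R36}"

lemma set_R_list: "set R_list = R_comm \<union> R_noncomm"
  by (auto simp: R_list_def R_comm_def R_noncomm_def)

text \<open>In the second alternative the orbit itself is reached, not only its closure; the
  rigidity of the noncommutative representatives depends on this.\<close>

lemma variety_cover:
  assumes c: "c \<in> minus11_variety"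
  shows "(\<exists>R\<in>R_comm. c \<in> zclosure (orbit R)) \<or> (\<exists>R\<in>R_noncomm. c \<in> orbit R)"
proof (cases "\<exists>v. v f1 = 0 \<and> v e1 * mult c v v e2 - v e2 * mult c v v e1 \<noteq> 0")
  case True
  then obtain v where v: "v f1 = 0" "v e1 * mult c v v e2 - v e2 * mult c v v e1 \<noteq> 0" by blast
  obtain g h K where g: "gl_even g h" and K: "K \<in> minus11_variety" "K e1 e1 e1 = 0" "K e1 e1 e2 = 1"
    and cK: "c = act g h K"
    by (rule cyclic_normal[OF c v(1) refl v(2)])
  obtain r s a b t where K': "K = cyc r s a b t" "a \<in> {0, r, s}" "b \<in> {0, r, s}"
    "t = 0 \<or> a = b \<and> a \<in> {r, s}"
    by (rule cyclic_form[OF K])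
  have "\<exists>R\<in>R_comm. K \<in> zclosure (orbit R)"
    unfolding R_comm_def K'(1) using cyc_cases[OF K'(2-4)] cyc_in_zclosure by fastforce
  then show ?thesis unfolding cK using act_in_zclosure_orbit[OF g] by blast
next
  case False
  then have W: "v e1 * mult c v v e2 = v e2 * mult c v v e1" if "v f1 = 0" for v
    using that by auto
  define v :: "complex \<Rightarrow> complex \<Rightarrow> vec" where
    "v x y = (\<lambda>i. case i of e1 \<Rightarrow> x | e2 \<Rightarrow> y | f1 \<Rightarrow> 0)" for x y
  \<comment> \<open>The wedge of v and v^2 is a cubic form in the two coordinates of v; its four
    coefficients are extracted from the values at (1, 0), (0, 1), (1, 1), (1, -1).\<close>
  have 0: "c e1 e1 e2 = 0" "c e2 e2 e1 = 0"
    using W[of "v 1 0"] W[of "v 0 1"] by (simp_all add: mult_def sum_idx v_def)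
  have "c e1 e1 e2 + c e1 e2 e2 + (c e2 e1 e2 + c e2 e2 e2) = c e1 e1 e1 + c e1 e2 e1 + (c e2 e1 e1 + c e2 e2 e1)"
    "c e1 e1 e2 - c e1 e2 e2 + (c e2 e2 e2 - c e2 e1 e2) = - (c e1 e1 e1 - c e1 e2 e1 + (c e2 e2 e1 - c e2 e1 e1))"
    using W[of "v 1 1"] W[of "v 1 (-1)"] by (simp_all add: mult_def sum_idx v_def algebra_simps)
  then have "2 * c e1 e1 e1 = 2 * (c e1 e2 e2 + c e2 e1 e2)" "2 * c e2 e2 e2 = 2 * (c e1 e2 e1 + c e2 e1 e1)"
    unfolding 0 by algebra+
  then have nc: "c e1 e1 e1 = c e1 e2 e2 + c e2 e1 e2" "c e2 e2 e2 = c e1 e2 e1 + c e2 e1 e1"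
    by (simp_all only: mult_cancel_left) simp_all
  from c 0 nc show ?thesis
  proof (cases rule: noncyclic_form)
    case (left p q m n)
    then have "c \<in> orbit (left_sc 1 0 m n)" using left_in_orbit by blast
    moreover have "left_sc 1 0 m n \<in> R_noncomm"
      using left(3,4) by (auto simp: R_noncomm_def R_left)
    ultimately show ?thesis by blast
  next
    case (right p q m n)
    then have "c \<in> orbit (right_sc 1 0 m n)" using right_in_orbit by blast
    moreover have "right_sc 1 0 m n \<in> R_noncomm"
      using right(3,4) by (auto simp: R_noncomm_def R_right)
    ultimately show ?thesis by blast
  next
    case (null x y)
    then show ?thesis using null_in_zclosure by (auto simp: R_comm_def)
  qed
qed

section \<open>Separation of the thirteen orbits\<close>

text \<open>On the orbit \<open>c e1 e2 e2\<close> is \<phi>(e1). The equations are linear, hence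
  persist in the closure, and they determine \<open>m\<close> and \<open>n\<close> wherever this
  coefficient is nonzero.\<close>

lemma left_orbit_closed:
  assumes "c \<in> zclosure (orbit (left_sc 1 0 m n))"
  shows "c e1 e2 e1 = 0 \<and> c e2 e1 e2 = 0 \<and> c e1 e1 e1 = c e1 e2 e2
    \<and> c e1 f1 f1 = m * c e1 e2 e2 \<and> c f1 e1 f1 = n * c e1 e2 e2"
proof -
  let ?Y = "{c. c e1 e2 e1 = 0 \<and> c e2 e1 e2 = 0 \<and> c e1 e1 e1 = c e1 e2 e2
    \<and> c e1 f1 f1 = m * c e1 e2 e2 \<and> c f1 e1 f1 = n * c e1 e2 e2}"
  have "zclosed ?Y" by (intro zclosed_conj zclosed_eq poly_funs_intros)
  moreover have "orbit (left_sc 1 0 m n) \<subseteq> ?Y"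
  proof
    fix c assume "c \<in> orbit (left_sc 1 0 m n)"
    then obtain g h where gh: "gl_even g h" and c: "c = act g h (left_sc 1 0 m n)" unfolding orbit_def by blast
    from gh obtain r s u v t where D: "r * v - s * u \<noteq> 0" "t \<noteq> 0"
      and g: "g = gmat r s u v t" "h = gmat_inv r s u v t" by (rule gl_even_cases)
    show "c \<in> ?Y"
      unfolding c g using D
      by (simp add: act_def sum_idx left_sc_def gmat_def gmat_inv_def divide_simps) (simp add: algebra_simps)
  qed
  ultimately show ?thesis using assms zclosure_minimal by blast
qed

lemma right_orbit_closed:
  assumes "c \<in> zclosure (orbit (right_sc 1 0 m n))"
  shows "c e1 e2 e2 = 0 \<and> c e2 e1 e1 = 0 \<and> c e1 e1 e1 = c e2 e1 e2
    \<and> c e1 f1 f1 = m * c e2 e1 e2 \<and> c f1 e1 f1 = n * c e2 e1 e2"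
proof -
  let ?Y = "{c. c e1 e2 e2 = 0 \<and> c e2 e1 e1 = 0 \<and> c e1 e1 e1 = c e2 e1 e2
    \<and> c e1 f1 f1 = m * c e2 e1 e2 \<and> c f1 e1 f1 = n * c e2 e1 e2}"
  have "zclosed ?Y" by (intro zclosed_conj zclosed_eq poly_funs_intros)
  moreover have "orbit (right_sc 1 0 m n) \<subseteq> ?Y"
  proof
    fix c assume "c \<in> orbit (right_sc 1 0 m n)"
    then obtain g h where gh: "gl_even g h" and c: "c = act g h (right_sc 1 0 m n)" unfolding orbit_def by blast
    from gh obtain r s u v t where D: "r * v - s * u \<noteq> 0" "t \<noteq> 0"
      and g: "g = gmat r s u v t" "h = gmat_inv r s u v t" by (rule gl_even_cases)
    show "c \<in> ?Y"
      unfolding c g using D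
      by (simp add: act_def sum_idx right_sc_def gmat_def gmat_inv_def divide_simps) (simp add: algebra_simps)
  qed
  ultimately show ?thesis using assms zclosure_minimal by blast
qed

text \<open>Matrix of left multiplication by \<open>e1 + e2\<close> on the even part; below,
  \<open>lodd\<close> and \<open>rodd\<close> are \<alpha> and \<beta> at the same vector.\<close>

definition lmat :: "sc \<Rightarrow> idx \<Rightarrow> idx \<Rightarrow> complex" where
  "lmat c k j = c e1 j k + c e2 j k"

definition ltr :: "sc \<Rightarrow> complex" where
  "ltr c = lmat c e1 e1 + lmat c e2 e2"

definition ldet :: "sc \<Rightarrow> complex" where
  "ldet c = lmat c e1 e1 * lmat c e2 e2 - lmat c e1 e2 * lmat c e2 e1"

definition lodd :: "sc \<Rightarrow> complex" where
  "lodd c = c e1 f1 f1 + c e2 f1 f1"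

definition rodd :: "sc \<Rightarrow> complex" where
  "rodd c = c f1 e1 f1 + c f1 e2 f1"

lemma l_poly: "ltr \<in> poly_funs" "ldet \<in> poly_funs" "lodd \<in> poly_funs" "rodd \<in> poly_funs"
  unfolding ltr_def[abs_def] ldet_def[abs_def] lodd_def[abs_def] rodd_def[abs_def] lmat_def
  by (intro poly_funs_intros)+

text \<open>The even columns of \<open>g\<close> are orthogonal idempotents. In this basis
  \<open>e1 + e2\<close> has coordinates \<open>x\<close>, \<open>y\<close>, which are the
  eigenvalues of its multiplication, and \<open>e1\<close> has coordinates \<open>u\<close>,
  \<open>v\<close>.\<close>

lemma idem_orbit_invariants:
  assumes "c \<in> orbit (idem a1 a2 b1 b2 t)"
  shows "\<exists>x y u v. ltr c = x + y \<and> ldet c = x * y \<and> lodd c = a1 * x + a2 * y \<and> rodd c = b1 * x + b2 * y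
    \<and> c e1 f1 f1 = a1 * u + a2 * v \<and> c f1 e1 f1 = b1 * u + b2 * v
    \<and> c e1 e2 e2 = c e2 e1 e2 \<and> (t = 0 \<longrightarrow> c f1 f1 e1 = 0)"
proof -
  obtain g h where gh: "gl_even g h" and c: "c = act g h (idem a1 a2 b1 b2 t)"
    using assms unfolding orbit_def by blast
  have z: "g e1 f1 = 0" "g e2 f1 = 0" "g f1 e1 = 0" "g f1 e2 = 0"
    "h e1 f1 = 0" "h e2 f1 = 0" "h f1 e1 = 0" "h f1 e2 = 0"
    using gh gl_even_inverse_even[OF gh] by (auto simp: gl_even_def)
  have hg: "(\<Sum>k\<in>UNIV. h i k * g k j) = (if i = j then 1 else 0)" for i j
    using gh by (simp add: gl_even_def)
  have H: "h e1 e1 * g e1 e1 + h e1 e2 * g e2 e1 = 1" "h e2 e1 * g e1 e2 + h e2 e2 * g e2 e2 = 1"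
    "h e1 e1 * g e1 e2 + h e1 e2 * g e2 e2 = 0" "h e2 e1 * g e1 e1 + h e2 e2 * g e2 e1 = 0"
    "h f1 f1 * g f1 f1 = 1"
    using hg[of e1 e1] hg[of e2 e2] hg[of e1 e2] hg[of e2 e1] hg[of f1 f1] by (simp_all add: sum_idx z)
  define x y where "x = h e1 e1 + h e1 e2" and "y = h e2 e1 + h e2 e2"
  have L: "lmat c k j = x * h e1 j * g k e1 + y * h e2 j * g k e2" if "deg j = 0" "deg k = 0" for j k
    using that unfolding c lmat_def x_def y_def
    by (cases j; cases k; simp add: act_def sum_idx idem_def z algebra_simps)
  have "ltr c = x * (h e1 e1 * g e1 e1 + h e1 e2 * g e2 e1) + y * (h e2 e1 * g e1 e2 + h e2 e2 * g e2 e2)"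
    by (simp add: ltr_def L algebra_simps)
  moreover have "ldet c = x * y * ((h e1 e1 * g e1 e1 + h e1 e2 * g e2 e1) * (h e2 e1 * g e1 e2 + h e2 e2 * g e2 e2)
      - (h e1 e1 * g e1 e2 + h e1 e2 * g e2 e2) * (h e2 e1 * g e1 e1 + h e2 e2 * g e2 e1))"
    by (simp add: ldet_def L algebra_simps)
  moreover have "c e1 f1 f1 = (h f1 f1 * g f1 f1) * (a1 * h e1 e1 + a2 * h e2 e1)"
    "c e2 f1 f1 = (h f1 f1 * g f1 f1) * (a1 * h e1 e2 + a2 * h e2 e2)"
    "c f1 e1 f1 = (h f1 f1 * g f1 f1) * (b1 * h e1 e1 + b2 * h e2 e1)"
    "c f1 e2 f1 = (h f1 f1 * g f1 f1) * (b1 * h e1 e2 + b2 * h e2 e2)"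
    unfolding c by (simp_all add: act_def sum_idx idem_def z algebra_simps)
  moreover have "c e1 e2 e2 = c e2 e1 e2" "t = 0 \<longrightarrow> c f1 f1 e1 = 0"
    unfolding c by (simp_all add: act_def sum_idx idem_def z algebra_simps)
  ultimately show ?thesis
    unfolding lodd_def rodd_def H
    by (intro exI[of _ x] exI[of _ y] exI[of _ "h e1 e1"] exI[of _ "h e2 e1"])
      (simp add: x_def y_def algebra_simps)
qed

lemma R_comm_idem: "R \<in> R_comm \<Longrightarrow> \<exists>a1 a2 b1 b2 t. R = idem a1 a2 b1 b2 t"
  unfolding R_comm_def R_idem by blast

lemma comm_closed:
  assumes "R \<in> R_comm" "c \<in> zclosure (orbit R)"
  shows "c e1 e2 e2 = c e2 e1 e2"
proof -
  have "orbit R \<subseteq> {c. c e1 e2 e2 = c e2 e1 e2}"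
    using R_comm_idem[OF assms(1)] by (auto dest!: idem_orbit_invariants)
  moreover have "zclosed {c :: sc. c e1 e2 e2 = c e2 e1 e2}" by (intro zclosed_eq poly_funs_intros)
  ultimately show ?thesis using assms(2) zclosure_minimal by blast
qed

text \<open>\<open>ldet c = l * (ltr c - l)\<close> is the characteristic equation: \<open>l\<close>
  is an eigenvalue of left multiplication by \<open>e1 + e2\<close>. At the representatives both
  eigenvalues are 1, so it forces \<open>l = 1\<close> there.\<close>

lemma R_comm_closed:
  "c \<in> zclosure (orbit R01) \<Longrightarrow> lodd c = 0 \<and> rodd c = 0"
  "c \<in> zclosure (orbit R03) \<Longrightarrow> c e1 f1 f1 = c f1 e1 f1 \<and> ldet c = lodd c * (ltr c - lodd c)"
  "c \<in> zclosure (orbit R04) \<Longrightarrow> lodd c = 0 \<and> ldet c = rodd c * (ltr c - rodd c)"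
  "c \<in> zclosure (orbit R05) \<Longrightarrow> rodd c = 0 \<and> ldet c = lodd c * (ltr c - lodd c)"
  "c \<in> zclosure (orbit R07) \<Longrightarrow> c f1 f1 e1 = 0 \<and> lodd c + rodd c = ltr c"
proof -
  have closed: "zclosed {c. lodd c = 0 \<and> rodd c = 0}"
    "zclosed {c. c e1 f1 f1 = c f1 e1 f1 \<and> ldet c = lodd c * (ltr c - lodd c)}"
    "zclosed {c. lodd c = 0 \<and> ldet c = rodd c * (ltr c - rodd c)}"
    "zclosed {c. rodd c = 0 \<and> ldet c = lodd c * (ltr c - lodd c)}"
    "zclosed {c. c f1 f1 e1 = 0 \<and> lodd c + rodd c = ltr c}"
    by (intro zclosed_conj zclosed_eq poly_funs_intros l_poly)+
  have inv: "c \<in> orbit R01 \<Longrightarrow> lodd c = 0 \<and> rodd c = 0"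
    "c \<in> orbit R03 \<Longrightarrow> c e1 f1 f1 = c f1 e1 f1 \<and> ldet c = lodd c * (ltr c - lodd c)"
    "c \<in> orbit R04 \<Longrightarrow> lodd c = 0 \<and> ldet c = rodd c * (ltr c - rodd c)"
    "c \<in> orbit R05 \<Longrightarrow> rodd c = 0 \<and> ldet c = lodd c * (ltr c - lodd c)"
    "c \<in> orbit R07 \<Longrightarrow> c f1 f1 e1 = 0 \<and> lodd c + rodd c = ltr c" for c
    unfolding R_idem by (drule idem_orbit_invariants, elim exE conjE, simp)+
  show "c \<in> zclosure (orbit R01) \<Longrightarrow> lodd c = 0 \<and> rodd c = 0"
    using zclosure_minimal[OF _ closed(1), of "orbit R01"] inv(1) by auto
  show "c \<in> zclosure (orbit R03) \<Longrightarrow> c e1 f1 f1 = c f1 e1 f1 \<and> ldet c = lodd c * (ltr c - lodd c)"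
    using zclosure_minimal[OF _ closed(2), of "orbit R03"] inv(2) by auto
  show "c \<in> zclosure (orbit R04) \<Longrightarrow> lodd c = 0 \<and> ldet c = rodd c * (ltr c - rodd c)"
    using zclosure_minimal[OF _ closed(3), of "orbit R04"] inv(3) by auto
  show "c \<in> zclosure (orbit R05) \<Longrightarrow> rodd c = 0 \<and> ldet c = lodd c * (ltr c - lodd c)"
    using zclosure_minimal[OF _ closed(4), of "orbit R05"] inv(4) by auto
  show "c \<in> zclosure (orbit R07) \<Longrightarrow> c f1 f1 e1 = 0 \<and> lodd c + rodd c = ltr c"
    using zclosure_minimal[OF _ closed(5), of "orbit R07"] inv(5) by auto
qed

lemma idem_values:
  "lodd (idem a1 a2 b1 b2 t) = a1 + a2" "rodd (idem a1 a2 b1 b2 t) = b1 + b2"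
  "ltr (idem a1 a2 b1 b2 t) = 2" "ldet (idem a1 a2 b1 b2 t) = 1"
  "idem a1 a2 b1 b2 t e1 f1 f1 = a1" "idem a1 a2 b1 b2 t f1 e1 f1 = b1" "idem a1 a2 b1 b2 t f1 f1 e1 = t"
  by (simp_all add: lodd_def rodd_def ltr_def ldet_def lmat_def idem_def)

lemma R_noncomm_iff:
  "R \<in> R_noncomm \<longleftrightarrow> (\<exists>m\<in>{0, 1}. \<exists>n\<in>{0, 1}. R = left_sc 1 0 m n \<or> R = right_sc 1 0 m n)"
  by (auto simp: R_noncomm_def R_left R_right)

lemma R_noncomm_not_comm: "R \<in> R_noncomm \<Longrightarrow> R e1 e2 e2 \<noteq> R e2 e1 e2"
  by (auto simp: R_noncomm_iff left_sc_def right_sc_def)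

lemma not_in_other_closure:
  assumes "R \<in> set R_list" "S \<in> set R_list" "R \<in> zclosure (orbit S)"
  shows "R = S"
proof (cases "S \<in> R_comm")
  case True
  then have "R \<in> R_comm"
    using comm_closed[OF True assms(3)] R_noncomm_not_comm assms(1) by (auto simp: set_R_list)
  then have R: "R = R01 \<or> R = R03 \<or> R = R04 \<or> R = R05 \<or> R = R07" by (simp add: R_comm_def)
  from True have "S = R01 \<or> S = R03 \<or> S = R04 \<or> S = R05 \<or> S = R07" by (simp add: R_comm_def)
  then show ?thesis
  proof (elim disjE)
    assume S: "S = R01"
    show ?thesis using R R_comm_closed(1)[of R] assms(3) unfolding S
      by (elim disjE) (simp_all add: R_idem idem_values)
  next
    assume S: "S = R03"
    show ?thesis using R R_comm_closed(2)[of R] assms(3) unfolding S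
      by (elim disjE) (simp_all add: R_idem idem_values)
  next
    assume S: "S = R04"
    show ?thesis using R R_comm_closed(3)[of R] assms(3) unfolding S
      by (elim disjE) (simp_all add: R_idem idem_values)
  next
    assume S: "S = R05"
    show ?thesis using R R_comm_closed(4)[of R] assms(3) unfolding S
      by (elim disjE) (simp_all add: R_idem idem_values)
  next
    assume S: "S = R07"
    show ?thesis using R R_comm_closed(5)[of R] assms(3) unfolding S
      by (elim disjE) (simp_all add: R_idem idem_values)
  qed
next
  case False
  then obtain m n where "S = left_sc 1 0 m n \<or> S = right_sc 1 0 m n"
    using assms(2) by (auto simp: set_R_list R_noncomm_iff)
  then have S: "R e1 e2 e1 = 0 \<and> R e2 e1 e2 = 0 \<and> R e1 e1 e1 = R e1 e2 e2
      \<and> R e1 f1 f1 = m * R e1 e2 e2 \<and> R f1 e1 f1 = n * R e1 e2 e2 \<and> S = left_sc 1 0 m n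
    \<or> R e1 e2 e2 = 0 \<and> R e2 e1 e1 = 0 \<and> R e1 e1 e1 = R e2 e1 e2
      \<and> R e1 f1 f1 = m * R e2 e1 e2 \<and> R f1 e1 f1 = n * R e2 e1 e2 \<and> S = right_sc 1 0 m n"
    using left_orbit_closed right_orbit_closed assms(3) by blast
  have "R \<notin> R_comm"
  proof
    assume "R \<in> R_comm"
    then obtain a1 a2 b1 b2 t where "R = idem a1 a2 b1 b2 t" using R_comm_idem by blast
    then show False using S by (auto simp: idem_def)
  qed
  then obtain m' n' where "R = left_sc 1 0 m' n' \<or> R = right_sc 1 0 m' n'"
    using assms(1) by (auto simp: set_R_list R_noncomm_iff)
  then show ?thesis using S by (auto simp: left_sc_def right_sc_def)
qed

section \<open>Rigidity\<close>

lemma poly_funs_mult_vec: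
  assumes "\<And>i. (\<lambda>c. x c i) \<in> poly_funs" "\<And>i. (\<lambda>c. y c i) \<in> poly_funs"
  shows "(\<lambda>c. mult c (x c) (y c) k) \<in> poly_funs"
  unfolding mult_def by (intro poly_funs_intros assms)

text \<open>In every \<open>idem\<close> algebra this vector has the roots 1 and 2, nonzero and
  distinct, so that \<open>disc\<close> does not vanish there.\<close>

definition v0 :: vec where
  "v0 = (\<lambda>i. case i of e1 \<Rightarrow> 1 | e2 \<Rightarrow> 2 | f1 \<Rightarrow> 0)"

definition wedge :: "vec \<Rightarrow> vec \<Rightarrow> complex" where
  "wedge x y = x e1 * y e2 - x e2 * y e1"

text \<open>If \<open>v0\<close> generates the even part with \<open>v0 (v0 - r) (v0 - s) = 0\<close>, then this is
  \<open>- r s (r - s)\<^sup>2\<close> times the fourth power of \<open>wedge v0 (v0\<^sup>2)\<close>.\<close>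

definition disc :: "sc \<Rightarrow> complex" where
  "disc c = (let w = mult c v0 v0; w' = mult c v0 w in
     wedge v0 w * wedge w' w * ((wedge v0 w')\<^sup>2 + 4 * wedge w' w * wedge v0 w))"

lemma disc_poly: "disc \<in> poly_funs"
  unfolding disc_def[abs_def] wedge_def Let_def
  by (intro poly_funs_intros poly_funs_mult_vec)

lemma disc_idem: "disc (idem a1 a2 b1 b2 t) \<noteq> 0"
  by (simp add: disc_def wedge_def Let_def mult_def sum_idx v0_def idem_def)

text \<open>Distinct nonzero roots place the algebra in an orbit itself, except when
  \<open>a = b \<noteq> 0\<close> and \<gamma> = 0: this is a proper degeneration of
  \<open>R03\<close>, excluded by \<open>c f1 f1 e1 \<noteq> 0\<close>.\<close>

lemma nondegenerate_in_orbit: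
  assumes c: "c \<in> minus11_variety" and d: "disc c \<noteq> 0"
  shows "\<exists>R\<in>R_comm. c \<in> zclosure (orbit R) \<and> (R \<noteq> R03 \<or> c f1 f1 e1 \<noteq> 0 \<longrightarrow> c \<in> orbit R)"
proof -
  define w w' where "w = mult c v0 v0" and "w' = mult c v0 w"
  have d': "wedge v0 w \<noteq> 0" "wedge w' w \<noteq> 0" "(wedge v0 w')\<^sup>2 + 4 * wedge w' w * wedge v0 w \<noteq> 0"
    using d by (simp_all add: disc_def Let_def w_def[symmetric] w'_def[symmetric])
  have v0: "v0 f1 = 0" by (simp add: v0_def)
  obtain g h K where g: "gl_even g h" and K: "K \<in> minus11_variety" "K e1 e1 e1 = 0" "K e1 e1 e2 = 1"
    and cK: "c = act g h K" and vw: "\<And>k. w' k = K e1 e2 e1 * v0 k + K e1 e2 e2 * w k"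
    using cyclic_normal[OF c v0 w_def] d'(1) unfolding wedge_def w'_def by metis
  obtain r s a b t where K': "K = cyc r s a b t" "a \<in> {0, r, s}" "b \<in> {0, r, s}"
    "t = 0 \<or> a = b \<and> a \<in> {r, s}"
    by (rule cyclic_form[OF K])
  have "wedge w' w = - (r * s) * wedge v0 w" "wedge v0 w' = (r + s) * wedge v0 w"
    by (simp_all add: wedge_def vw K'(1) cyc_def algebra_simps)
  then have "- (r * s) * wedge v0 w \<noteq> 0" "(r - s)\<^sup>2 * (wedge v0 w)\<^sup>2 \<noteq> 0"
    using d' by (simp_all add: power2_eq_square algebra_simps)
  then have rs: "r \<noteq> 0" "s \<noteq> 0" "r \<noteq> s" by auto
  have "\<exists>R\<in>R_comm. K \<in> zclosure (orbit R) \<and> (R \<noteq> R03 \<or> t \<noteq> 0 \<longrightarrow> K \<in> orbit R)"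
  proof -
    note O = cyc_in_orbit[OF rs] cyc_in_orbit[OF rs(2,1) rs(3)[symmetric]]
    have C: "\<exists>R\<in>R_comm. K \<in> zclosure (orbit R) \<and> (R \<noteq> R03 \<or> t \<noteq> 0 \<longrightarrow> K \<in> orbit R)"
      if "R \<in> R_comm" "K \<in> orbit R" for R
      using that zclosure_subset by blast
    have D: "\<exists>R\<in>R_comm. K \<in> zclosure (orbit R) \<and> (R \<noteq> R03 \<or> t \<noteq> 0 \<longrightarrow> K \<in> orbit R)"
      if "K \<in> zclosure (orbit R03)" "t \<noteq> 0 \<longrightarrow> K \<in> orbit R03"
      using that by (intro bexI[of _ R03]) (auto simp: R_comm_def)
    have "K \<in> {cyc r s 0 0 0, cyc r s 0 r 0, cyc s r 0 s 0, cyc r s r 0 0, cyc s r s 0 0,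
      cyc r s s r 0, cyc s r r s 0, cyc r s r r t, cyc s r s s t}"
      unfolding K'(1) by (rule cyc_cases[OF K'(2-4)])
    then consider "K = cyc r s 0 0 0" | "K = cyc r s 0 r 0" | "K = cyc s r 0 s 0" | "K = cyc r s r 0 0"
      | "K = cyc s r s 0 0" | "K = cyc r s s r 0" | "K = cyc s r r s 0" | "K = cyc r s r r t"
      | "K = cyc s r s s t" by blast
    then show ?thesis
    proof cases
      case 1 then show ?thesis using C[of R01] O by (simp add: R_comm_def)
    next
      case 2 then show ?thesis using C[of R04] O by (simp add: R_comm_def)
    next
      case 3 then show ?thesis using C[of R04] O by (simp add: R_comm_def)
    next
      case 4 then show ?thesis using C[of R05] O by (simp add: R_comm_def)
    next
      case 5 then show ?thesis using C[of R05] O by (simp add: R_comm_def)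
    next
      case 6 then show ?thesis using C[of R07] O by (simp add: R_comm_def)
    next
      case 7 then show ?thesis using C[of R07] O by (simp add: R_comm_def)
    next
      case 8 then show ?thesis using D O(2) cyc_in_zclosure(2) by simp
    next
      case 9 then show ?thesis using D O(7) cyc_in_zclosure(2) by simp
    qed
  qed
  then obtain R where R: "R \<in> R_comm" "K \<in> zclosure (orbit R)" "R \<noteq> R03 \<or> t \<noteq> 0 \<longrightarrow> K \<in> orbit R" by blast
  have "t \<noteq> 0" if "c f1 f1 e1 \<noteq> 0"
  proof
    assume "t = 0"
    then have "K f1 f1 k = 0" for k by (cases k) (simp_all add: K'(1) cyc_def)
    moreover have "h e1 f1 = 0" "h e2 f1 = 0" using gl_even_inverse_even[OF g] by simp_all
    ultimately have "act g h K f1 f1 e1 = 0" by (simp add: act_def sum_idx)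
    with that cK show False by simp
  qed
  then show ?thesis
    unfolding cK using R act_in_orbit[OF g] act_in_zclosure_orbit[OF g] cK by blast
qed

lemma R_list_rigid:
  assumes R: "R \<in> set R_list"
  shows "rigid_in minus11_variety R"
proof -
  define U where "U = (\<Union>S\<in>set R_list - {R}. zclosure (orbit S))"
  have U: "zclosed U" unfolding U_def by (intro zclosed_UN zclosed_zclosure) simp
  have RU: "R \<notin> U" unfolding U_def using not_in_other_closure[OF R] by auto
  have RX: "R \<in> minus11_variety" using R R_list_in_variety by blast
  show ?thesis
  proof (cases "R \<in> R_comm")
    case True
    define q :: "sc \<Rightarrow> complex" where "q c = disc c * (if R = R03 then c f1 f1 e1 else 1)" for c
    have "q \<in> poly_funs"
      unfolding q_def[abs_def] using disc_poly by (cases "R = R03") (simp_all add: poly_funs_intros)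
    then have "zclosed ({c. q c = 0} \<union> U)" by (intro zclosed_Un zclosed_zeros U)
    moreover have "q R \<noteq> 0"
    proof -
      obtain a1 a2 b1 b2 t where "R = idem a1 a2 b1 b2 t" using R_comm_idem[OF True] by blast
      then have "disc R \<noteq> 0" using disc_idem by simp
      moreover have "R03 f1 f1 e1 = 1" by (simp add: R_idem idem_values)
      ultimately show ?thesis by (simp add: q_def)
    qed
    moreover have "minus11_variety - ({c. q c = 0} \<union> U) \<subseteq> orbit R"
    proof
      fix c assume "c \<in> minus11_variety - ({c. q c = 0} \<union> U)"
      then have c: "c \<in> minus11_variety" "q c \<noteq> 0" "c \<notin> U" by auto
      then have "disc c \<noteq> 0" by (auto simp: q_def)
      from nondegenerate_in_orbit[OF c(1) this] obtain S where S: "S \<in> R_comm" "c \<in> zclosure (orbit S)"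
        "S \<noteq> R03 \<or> c f1 f1 e1 \<noteq> 0 \<longrightarrow> c \<in> orbit S" by blast
      then have "S = R" using c(3) by (auto simp: U_def set_R_list)
      then show "c \<in> orbit R" using S c(2) by (auto simp: q_def)
    qed
    ultimately show ?thesis using RX RU by (intro rigid_via_neighbourhood) auto
  next
    case False
    then have RN: "R \<in> R_noncomm" using R by (simp add: set_R_list)
    \<comment> \<open>This equation holds on all closures of commutative representatives, so outside
      it \<open>variety_cover\<close> yields an orbit.\<close>
    have "zclosed ({c. c e1 e2 e2 = c e2 e1 e2} \<union> U)"
      by (intro zclosed_Un zclosed_eq poly_funs_intros U)
    moreover have "minus11_variety - ({c. c e1 e2 e2 = c e2 e1 e2} \<union> U) \<subseteq> orbit R"
    proof
      fix c assume "c \<in> minus11_variety - ({c. c e1 e2 e2 = c e2 e1 e2} \<union> U)"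
      then have c: "c \<in> minus11_variety" "c e1 e2 e2 \<noteq> c e2 e1 e2" "c \<notin> U" by auto
      then obtain S where S: "S \<in> R_noncomm" "c \<in> orbit S"
        using variety_cover[OF c(1)] comm_closed by blast
      then have "S = R" using c(3) zclosure_subset[of "orbit S"] by (auto simp: U_def set_R_list)
      then show "c \<in> orbit R" using S by simp
    qed
    ultimately show ?thesis
      using RX RU R_noncomm_not_comm[OF RN] by (intro rigid_via_neighbourhood) auto
  qed
qed

section \<open>Components, dimension and the count of rigid algebras\<close>

lemma variety_eq_UN: "minus11_variety = (\<Union>R\<in>set R_list. zclosure (orbit R))"
proof
  show "minus11_variety \<subseteq> (\<Union>R\<in>set R_list. zclosure (orbit R))"
  proof
    fix c assume "c \<in> minus11_variety"
    from variety_cover[OF this] show "c \<in> (\<Union>R\<in>set R_list. zclosure (orbit R))"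
      using zclosure_subset unfolding set_R_list by blast
  qed
  show "(\<Union>R\<in>set R_list. zclosure (orbit R)) \<subseteq> minus11_variety"
    using zclosure_orbit_subset_variety R_list_in_variety by blast
qed

text \<open>An open set meeting the closure of an orbit meets the orbit itself.\<close>

lemma rigid_orbit:
  assumes c: "c \<in> minus11_variety" "rigid_in minus11_variety c"
  shows "\<exists>R\<in>set R_list. orbit c = orbit R"
proof -
  obtain Z where Z: "zclosed Z" "orbit c = minus11_variety - Z" using c(2) unfolding rigid_in_def by blast
  obtain R where R: "R \<in> set R_list" "c \<in> zclosure (orbit R)" using c(1) variety_eq_UN by blast
  have "\<not> orbit R \<subseteq> Z"
  proof
    assume "orbit R \<subseteq> Z"
    from zclosure_minimal[OF this Z(1)] R(2) have "c \<in> Z" by blast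
    then show False using orbit_self[of c] Z(2) by blast
  qed
  then obtain d where d: "d \<in> orbit R" "d \<notin> Z" by blast
  moreover have "d \<in> minus11_variety" using orbit_subset_variety R_list_in_variety R(1) d(1) by blast
  ultimately have "d \<in> orbit c" using Z(2) by blast
  then have "orbit c = orbit R" using orbit_eq d(1) by metis
  with R(1) show ?thesis by blast
qed

lemma card_R_list: "card (set R_list) = 13"
proof -
  \<comment> \<open>Five structure constants that tell the thirteen tables apart.\<close>
  have "distinct (map (\<lambda>c. (c e1 e2 e2, c e2 e1 e2, c e1 f1 f1, c f1 e1 f1, c e2 f1 f1)) R_list)"
    by (simp add: R_list_def R01_def R03_def R04_def R05_def R07_def R23_def R25_def R26_def
      R29_def R31_def R32_def R33_def R36_def mk_def)
  then have "distinct R_list" by (simp only: distinct_map)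
  then show ?thesis by (simp add: distinct_card) (simp add: R_list_def)
qed

theorem mainTheorem14:
  shows "var_dim minus11_variety = 5
    \<and> irr_components minus11_variety = (\<lambda>c. zclosure (orbit c)) ` set R_list
    \<and> card (irr_components minus11_variety) = 13
    \<and> card {orbit c | c. c \<in> minus11_variety \<and> rigid_in minus11_variety c} = 13"
proof (intro conjI)
  have anti: "R = S" if "R \<in> set R_list" "S \<in> set R_list" "zclosure (orbit R) \<subseteq> zclosure (orbit S)" for R S
    using not_in_other_closure[OF that(1,2)] that(3) zclosure_subset orbit_self by blast
  show comps: "irr_components minus11_variety = (\<lambda>c. zclosure (orbit c)) ` set R_list"
    unfolding variety_eq_UN by (intro irr_components_UN anti zirreducible_orbit) auto
  have inj: "inj_on (\<lambda>c. zclosure (orbit c)) (set R_list)"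
    by (rule inj_onI) (auto intro: anti)
  show "card (irr_components minus11_variety) = 13"
    unfolding comps using card_image[OF inj] card_R_list by simp
  have "{orbit c | c. c \<in> minus11_variety \<and> rigid_in minus11_variety c} = orbit ` set R_list"
    using rigid_orbit R_list_rigid R_list_in_variety by blast
  moreover have "inj_on orbit (set R_list)"
    using inj by (auto simp: inj_on_def)
  ultimately show "card {orbit c | c. c \<in> minus11_variety \<and> rigid_in minus11_variety c} = 13"
    using card_image card_R_list by metis
  show "var_dim minus11_variety = 5"
    unfolding var_dim_def comps
  proof (rule antisym)
    show "Sup (zdim ` (\<lambda>c. zclosure (orbit c)) ` set R_list) \<le> 5"
      by (rule Sup_least) (auto simp: zdim_orbit_le)
    have "R03 \<in> set R_list" by (simp add: R_list_def)
    then show "5 \<le> Sup (zdim ` (\<lambda>c. zclosure (orbit c)) ` set R_list)"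
      unfolding zdim_orbit_R03[symmetric] by (intro Sup_upper) blast
  qed
qed

end
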